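(* (a) The growth rate $\omega(\mathcal{L}_2,\{a,t\})$ is equal to $\frac{1+\sqrt5}{2}$. (b) For every integer $k\ge1$, $$\omega(BS(1,2k+1),\{a,t\})=\omega(\mathcal{L}_{2k+1},\{a,t\})=\omega_k.$$ (c) The growth rate $\omega(BS(1,2),\{a,t\})$ is equal to the positive root of $x^3-x^2-2$.
   Context: For a finitely generated group $G$ and a finite generating set $S$ of $G$, let $\ell_{G,S}(g)$ be the minimal length of a word in $S\cup S^{-1}$ representing $g\in G$, let $F_{G,S}(n)$ be the number of $g\in G$ with $\ell_{G,S}(g)\le n$, and define the exponential growth rate $\omega(G,S)=\lim_{n\to\infty}F_{G,S}(n)^{1/n}$ (the limit exists). $BS(1,n)=\langle a,t\mid tat^{-1}=a^n\rangle$. $\mathcal{L}_n=(\mathbb{Z}/n\mathbb{Z})\wr\mathbb{Z}$ is the restricted wreath product, with presentation $\langle a,t\mid a^n=1,\ [t^kat^{-k},a]=1\ (k=1,2,\ldots)\rangle$. For $k\ge1$, $\omega_k$ denotes the unique positive root of $T_k(x)=x^{k+1}-x^k-2x^{k-1}-\dots-2x-2=x^{k+1}-x^k-2\sum_{j=0}^{k-1}x^j$. *)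

theory Defs
  imports Complex_Main "HOL-Algebra.Elementary_Groups" "HOL-Algebra.Product_Groups"
begin

text \<open>For an element outside the subgroup generated by \<open>S\<close> the word length is unspecified; it is only
  meant to be used when \<open>S\<close> is a finite generating set of \<open>G\<close>.\<close>

definition word_length :: "('a, 'b) monoid_scheme \<Rightarrow> 'a set \<Rightarrow> 'a \<Rightarrow> nat" where
  "word_length G S g =
     (LEAST m. \<exists>ws. set ws \<subseteq> S \<union> m_inv G ` S \<and> length ws = m \<and>
                    foldr (\<otimes>\<^bsub>G\<^esub>) ws \<one>\<^bsub>G\<^esub> = g)"

definition growth_function :: "('a, 'b) monoid_scheme \<Rightarrow> 'a set \<Rightarrow> nat \<Rightarrow> nat" where
  "growth_function G S n = card {g \<in> carrier G. word_length G S g \<le> n}"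

definition growth_rate :: "('a, 'b) monoid_scheme \<Rightarrow> 'a set \<Rightarrow> real" where
  "growth_rate G S = lim (\<lambda>n. root n (real (growth_function G S n)))"

text \<open>A letter \<open>(g, True)\<close> stands for the generator \<open>g\<close>, and \<open>(g, False)\<close> for its formal inverse.
  A pair \<open>(u, v)\<close> in \<open>R\<close> is the defining relation \<open>u = v\<close>.\<close>

type_synonym 'g word = "('g \<times> bool) list"

inductive pres_eq :: "('g word \<times> 'g word) set \<Rightarrow> 'g word \<Rightarrow> 'g word \<Rightarrow> bool"
  for R :: "('g word \<times> 'g word) set" where
  pres_refl: "pres_eq R u u"
| pres_sym: "pres_eq R u v \<Longrightarrow> pres_eq R v u"
| pres_trans: "pres_eq R u v \<Longrightarrow> pres_eq R v w \<Longrightarrow> pres_eq R u w"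
| pres_append: "pres_eq R u u' \<Longrightarrow> pres_eq R v v' \<Longrightarrow> pres_eq R (u @ v) (u' @ v')"
| pres_cancel: "pres_eq R [(g, b), (g, \<not> b)] []"
| pres_rel: "(u, v) \<in> R \<Longrightarrow> pres_eq R u v"

definition pres_class :: "('g word \<times> 'g word) set \<Rightarrow> 'g word \<Rightarrow> 'g word set" where
  "pres_class R w = {v. pres_eq R w v}"

definition presented_group :: "('g word \<times> 'g word) set \<Rightarrow> 'g word set monoid" where
  "presented_group R =
     \<lparr>carrier = range (pres_class R),
      monoid.mult = (\<lambda>X Y. \<Union>u\<in>X. \<Union>v\<in>Y. pres_class R (u @ v)),
      one = pres_class R []\<rparr>"

lemma pres_class_eq_iff: "pres_class R u = pres_class R v \<longleftrightarrow> pres_eq R u v"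
  unfolding pres_class_def by (blast intro: pres_refl pres_sym pres_trans)

lemma pres_class_mult [simp]:
  "pres_class R u \<otimes>\<^bsub>presented_group R\<^esub> pres_class R v = pres_class R (u @ v)"
proof -
  have *: "pres_class R (u' @ v') = pres_class R (u @ v)"
    if "u' \<in> pres_class R u" "v' \<in> pres_class R v" for u' v'
    using that by (simp add: pres_class_eq_iff) (simp add: pres_class_def pres_append pres_sym)
  have uv: "u \<in> pres_class R u" "v \<in> pres_class R v"
    by (auto simp: pres_class_def pres_refl)
  have "(\<Union>u'\<in>pres_class R u. \<Union>v'\<in>pres_class R v. pres_class R (u' @ v'))
      = (\<Union>u'\<in>pres_class R u. \<Union>v'\<in>pres_class R v. pres_class R (u @ v))"
    by (intro SUP_cong refl *)
  also have "\<dots> = pres_class R (u @ v)"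
    using uv by blast
  finally show ?thesis
    by (simp add: presented_group_def)
qed

lemma pres_eq_inverse: "pres_eq R (map (\<lambda>(g, b). (g, \<not> b)) (rev w) @ w) []"
proof (induction w)
  case (Cons x w)
  obtain g b where x: "x = (g, b)" by fastforce
  let ?i = "map (\<lambda>(g, b). (g, \<not> b)) (rev w)"
  have "pres_eq R ([(g, \<not> b), (g, b)] @ w) ([] @ w)"
    using pres_append[OF pres_cancel[of R g "\<not> b"] pres_refl] by simp
  then have "pres_eq R (?i @ [(g, \<not> b), (g, b)] @ w) (?i @ w)"
    using pres_append[OF pres_refl] by fastforce
  then show ?case
    using Cons.IH pres_trans x by fastforce
qed (simp add: pres_refl)

lemma carrier_presented_group: "carrier (presented_group R) = range (pres_class R)"
  by (simp add: presented_group_def)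

lemma one_presented_group: "\<one>\<^bsub>presented_group R\<^esub> = pres_class R []"
  by (simp add: presented_group_def)

lemma pres_class_inverse:
  "pres_class R (map (\<lambda>(g, b). (g, \<not> b)) (rev w)) \<otimes>\<^bsub>presented_group R\<^esub> pres_class R w
     = \<one>\<^bsub>presented_group R\<^esub>"
  unfolding pres_class_mult one_presented_group pres_class_eq_iff by (rule pres_eq_inverse)

lemma group_presented_group: "group (presented_group R)"
proof (rule groupI)
  fix x assume "x \<in> carrier (presented_group R)"
  then obtain w where w: "x = pres_class R w"
    by (auto simp: carrier_presented_group)
  show "\<one>\<^bsub>presented_group R\<^esub> \<otimes>\<^bsub>presented_group R\<^esub> x = x"
    by (simp add: one_presented_group w)
  show "\<exists>y\<in>carrier (presented_group R). y \<otimes>\<^bsub>presented_group R\<^esub> x = \<one>\<^bsub>presented_group R\<^esub>"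
    using pres_class_inverse[of R w] unfolding w carrier_presented_group by blast
qed (auto simp: carrier_presented_group one_presented_group)

lemma inv_pres_class:
  "inv\<^bsub>presented_group R\<^esub> (pres_class R w) = pres_class R (map (\<lambda>(g, b). (g, \<not> b)) (rev w))"
  by (rule group.inv_equality[OF group_presented_group pres_class_inverse])
     (auto simp: carrier_presented_group)

lemma generate_presented_group:
  "generate (presented_group R) (range (\<lambda>g. pres_class R [(g, True)])) = carrier (presented_group R)"
    (is "generate ?G ?S = _")
proof
  show "generate ?G ?S \<subseteq> carrier ?G"
    by (rule group.generate_incl[OF group_presented_group]) (auto simp: carrier_presented_group)
next
  have "pres_class R w \<in> generate ?G ?S" for w
  proof (induction w)
    case Nil
    show ?case using generate.one[of ?G ?S] by (simp add: one_presented_group)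
  next
    case (Cons x w)
    obtain g b where x: "x = (g, b)" by fastforce
    have "pres_class R [(g, True)] \<in> generate ?G ?S"
      by (rule generate.incl) simp
    moreover have "inv\<^bsub>?G\<^esub> (pres_class R [(g, True)]) \<in> generate ?G ?S"
      by (rule generate.inv) simp
    ultimately have "pres_class R [x] \<in> generate ?G ?S"
      unfolding x inv_pres_class by (cases b) auto
    then show ?case
      using generate.eng[OF _ Cons.IH, of "pres_class R [x]"] by simp
  qed
  then show "carrier ?G \<subseteq> generate ?G ?S"
    by (auto simp: carrier_presented_group)
qed

datatype bs_gen = Gen_a | Gen_t

definition BS1_relations :: "nat \<Rightarrow> (bs_gen word \<times> bs_gen word) set" where
  "BS1_relations n =
     {([(Gen_t, True), (Gen_a, True), (Gen_t, False)], replicate n (Gen_a, True))}"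

definition BS1 :: "nat \<Rightarrow> bs_gen word set monoid" where
  "BS1 n = presented_group (BS1_relations n)"

definition BS1_a :: "nat \<Rightarrow> bs_gen word set" where
  "BS1_a n = pres_class (BS1_relations n) [(Gen_a, True)]"

definition BS1_t :: "nat \<Rightarrow> bs_gen word set" where
  "BS1_t n = pres_class (BS1_relations n) [(Gen_t, True)]"

lemma group_BS1: "group (BS1 n)"
  unfolding BS1_def by (rule group_presented_group)

lemma UNIV_bs_gen: "UNIV = {Gen_a, Gen_t}"
  by (auto intro: bs_gen.exhaust)

lemma generate_BS1: "generate (BS1 n) {BS1_a n, BS1_t n} = carrier (BS1 n)"
proof -
  have "range (\<lambda>g. pres_class (BS1_relations n) [(g, True)]) = {BS1_a n, BS1_t n}"
    by (simp add: UNIV_bs_gen BS1_a_def BS1_t_def)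
  then show ?thesis
    using generate_presented_group[of "BS1_relations n"] by (simp only: BS1_def)
qed

text \<open>The semidirect product of the direct sum of copies of \<open>A\<close> indexed by \<open>B\<close> with \<open>B\<close>,
  where \<open>B\<close> acts by left translation of the index.\<close>

definition restricted_wreath ::
    "('a, 'm) monoid_scheme \<Rightarrow> ('b, 'n) monoid_scheme \<Rightarrow> (('b \<Rightarrow> 'a) \<times> 'b) monoid" where
  "restricted_wreath A B =
     \<lparr>carrier = carrier (sum_group (carrier B) (\<lambda>_. A)) \<times> carrier B,
      monoid.mult = (\<lambda>(f, b) (g, c).
        (f \<otimes>\<^bsub>sum_group (carrier B) (\<lambda>_. A)\<^esub> (\<lambda>x\<in>carrier B. g (inv\<^bsub>B\<^esub> b \<otimes>\<^bsub>B\<^esub> x)), b \<otimes>\<^bsub>B\<^esub> c)),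
      one = (\<one>\<^bsub>sum_group (carrier B) (\<lambda>_. A)\<^esub>, \<one>\<^bsub>B\<^esub>)\<rparr>"

definition lamplighter :: "nat \<Rightarrow> ((int \<Rightarrow> int) \<times> int) monoid" where
  "lamplighter n = restricted_wreath (integer_mod_group n) integer_group"

text \<open>\<open>lamp_a\<close> is the generator \<open>1\<close> of the copy of \<open>\<int>/n\<int>\<close> at index \<open>0\<close> (for \<open>n \<ge> 2\<close>);
  \<open>lamp_t\<close> is the generator \<open>1\<close> of \<open>\<int>\<close>.\<close>

definition lamp_a :: "(int \<Rightarrow> int) \<times> int" where
  "lamp_a = ((\<lambda>i. if i = 0 then 1 else 0), 0)"

definition lamp_t :: "(int \<Rightarrow> int) \<times> int" where
  "lamp_t = ((\<lambda>i. 0), 1)"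

lemma group_restricted_wreath:
  assumes "group A" "group B"
  shows "group (restricted_wreath A B)"
proof -
  interpret A: group A by fact
  interpret B: group B by fact
  let ?N = "sum_group (carrier B) (\<lambda>_. A)"
  interpret N: group ?N by (simp add: A.is_group)
  have shift: "(\<lambda>x\<in>carrier B. g (inv\<^bsub>B\<^esub> b \<otimes>\<^bsub>B\<^esub> x)) \<in> carrier ?N"
    if "g \<in> carrier ?N" "b \<in> carrier B" for g b
  proof -
    have g: "g \<in> carrier B \<rightarrow>\<^sub>E carrier A" "finite {x \<in> carrier B. g x \<noteq> \<one>\<^bsub>A\<^esub>}"
      using that by (auto simp: carrier_sum_group A.is_group)
    have "{x \<in> carrier B. g (inv\<^bsub>B\<^esub> b \<otimes>\<^bsub>B\<^esub> x) \<noteq> \<one>\<^bsub>A\<^esub>}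
            \<subseteq> (\<lambda>y. b \<otimes>\<^bsub>B\<^esub> y) ` {x \<in> carrier B. g x \<noteq> \<one>\<^bsub>A\<^esub>}"
    proof
      fix x assume x: "x \<in> {x \<in> carrier B. g (inv\<^bsub>B\<^esub> b \<otimes>\<^bsub>B\<^esub> x) \<noteq> \<one>\<^bsub>A\<^esub>}"
      then show "x \<in> (\<lambda>y. b \<otimes>\<^bsub>B\<^esub> y) ` {x \<in> carrier B. g x \<noteq> \<one>\<^bsub>A\<^esub>}"
        using that(2) by (intro image_eqI[of _ _ "inv\<^bsub>B\<^esub> b \<otimes>\<^bsub>B\<^esub> x"]) (auto simp: B.m_assoc[symmetric])
    qed
    then have "finite {x \<in> carrier B. g (inv\<^bsub>B\<^esub> b \<otimes>\<^bsub>B\<^esub> x) \<noteq> \<one>\<^bsub>A\<^esub>}"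
      using g(2) finite_subset by blast
    then show ?thesis
      using g(1) that(2) by (auto simp: carrier_sum_group A.is_group PiE_iff cong: conj_cong)
  qed
  have mem: "f x \<in> carrier A" if "f \<in> carrier ?N" "x \<in> carrier B" for f x
    using that by (auto simp: carrier_sum_group A.is_group)
  have ext: "(\<lambda>x\<in>carrier B. f x) = f" if "f \<in> carrier ?N" for f
    using that by (auto simp: carrier_sum_group A.is_group)
  have mult: "(f, b) \<otimes>\<^bsub>restricted_wreath A B\<^esub> (g, c)
      = ((\<lambda>x\<in>carrier B. f x \<otimes>\<^bsub>A\<^esub> g (inv\<^bsub>B\<^esub> b \<otimes>\<^bsub>B\<^esub> x)), b \<otimes>\<^bsub>B\<^esub> c)" for f b g c
    by (auto simp: restricted_wreath_def cong: restrict_cong)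
  have carr: "carrier (restricted_wreath A B) = carrier ?N \<times> carrier B"
    by (simp add: restricted_wreath_def)
  have one: "\<one>\<^bsub>restricted_wreath A B\<^esub> = ((\<lambda>x\<in>carrier B. \<one>\<^bsub>A\<^esub>), \<one>\<^bsub>B\<^esub>)"
    by (simp add: restricted_wreath_def)
  show ?thesis
  proof (rule groupI)
    fix p q assume "p \<in> carrier (restricted_wreath A B)" "q \<in> carrier (restricted_wreath A B)"
    then show "p \<otimes>\<^bsub>restricted_wreath A B\<^esub> q \<in> carrier (restricted_wreath A B)"
      using shift N.m_closed by (auto simp: restricted_wreath_def simp del: mult_sum_group)
  next
    show "\<one>\<^bsub>restricted_wreath A B\<^esub> \<in> carrier (restricted_wreath A B)"
      using N.one_closed by (auto simp: restricted_wreath_def simp del: one_sum_group)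
  next
    fix p q r
    assume "p \<in> carrier (restricted_wreath A B)" "q \<in> carrier (restricted_wreath A B)"
      "r \<in> carrier (restricted_wreath A B)"
    then show "p \<otimes>\<^bsub>restricted_wreath A B\<^esub> q \<otimes>\<^bsub>restricted_wreath A B\<^esub> r
        = p \<otimes>\<^bsub>restricted_wreath A B\<^esub> (q \<otimes>\<^bsub>restricted_wreath A B\<^esub> r)"
      by (cases p; cases q; cases r)
         (auto simp: carr mult mem A.m_assoc B.m_assoc B.inv_mult_group cong: restrict_cong)
  next
    fix p assume "p \<in> carrier (restricted_wreath A B)"
    then show "\<one>\<^bsub>restricted_wreath A B\<^esub> \<otimes>\<^bsub>restricted_wreath A B\<^esub> p = p"
      by (cases p) (auto simp: carr one mult mem ext cong: restrict_cong)
  next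
    fix p assume p: "p \<in> carrier (restricted_wreath A B)"
    obtain f b where fb: "p = (f, b)" "f \<in> carrier ?N" "b \<in> carrier B"
      using p by (cases p) (auto simp: carr)
    let ?g = "\<lambda>x\<in>carrier B. (inv\<^bsub>?N\<^esub> f) (inv\<^bsub>B\<^esub> (inv\<^bsub>B\<^esub> b) \<otimes>\<^bsub>B\<^esub> x)"
    have "?g \<in> carrier ?N"
      using shift[of "inv\<^bsub>?N\<^esub> f" "inv\<^bsub>B\<^esub> b"] fb by blast
    moreover have "(?g, inv\<^bsub>B\<^esub> b) \<otimes>\<^bsub>restricted_wreath A B\<^esub> p = \<one>\<^bsub>restricted_wreath A B\<^esub>"
      using fb by (auto simp: one mult mem A.is_group cong: restrict_cong)
    ultimately show "\<exists>q\<in>carrier (restricted_wreath A B).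
        q \<otimes>\<^bsub>restricted_wreath A B\<^esub> p = \<one>\<^bsub>restricted_wreath A B\<^esub>"
      using fb(3) by (intro bexI[of _ "(?g, inv\<^bsub>B\<^esub> b)"]) (auto simp: carr)
  qed
qed

lemma group_lamplighter: "group (lamplighter n)"
  unfolding lamplighter_def by (intro group_restricted_wreath) simp_all

lemma carrier_lamplighter:
  "carrier (lamplighter n) =
     {f. (\<forall>i. f i \<in> carrier (integer_mod_group n)) \<and> finite {i. f i \<noteq> 0}} \<times> UNIV"
  by (auto simp: lamplighter_def restricted_wreath_def carrier_sum_group PiE_iff)

lemma one_lamplighter: "\<one>\<^bsub>lamplighter n\<^esub> = (\<lambda>i. 0, 0)"
  by (simp add: lamplighter_def restricted_wreath_def restrict_def)

lemma mult_lamplighter: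
  "(f, b) \<otimes>\<^bsub>lamplighter n\<^esub> (g, c) = (\<lambda>i. (f i + g (i - b)) mod int n, b + c)"
  by (simp add: lamplighter_def restricted_wreath_def restrict_def)

lemma generate_lamplighter:
  assumes "n \<ge> 2"
  shows "generate (lamplighter n) {lamp_a, lamp_t} = carrier (lamplighter n)"
proof
  interpret G: group "lamplighter n" by (rule group_lamplighter)
  let ?H = "generate (lamplighter n) {lamp_a, lamp_t}"
  have S: "{lamp_a, lamp_t} \<subseteq> carrier (lamplighter n)"
    using assms by (auto simp: carrier_lamplighter carrier_integer_mod_group lamp_a_def lamp_t_def)
  show "?H \<subseteq> carrier (lamplighter n)"
    using S by (rule G.generate_incl)
  have a: "lamp_a \<in> ?H" and t: "lamp_t \<in> ?H"
    by (auto intro: generate.incl)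
  have t': "(\<lambda>i. 0, -1) \<in> ?H"
  proof -
    have "inv\<^bsub>lamplighter n\<^esub> lamp_t = (\<lambda>i. 0, -1)"
      using S by (intro G.inv_equality)
        (auto simp: one_lamplighter mult_lamplighter lamp_t_def carrier_lamplighter)
    then show ?thesis
      by (metis generate.inv insertCI)
  qed
  have tpos: "(\<lambda>i. 0, int m) \<in> ?H" for m
  proof (induction m)
    case 0
    show ?case using generate.one[of "lamplighter n"] by (simp add: one_lamplighter)
  next
    case (Suc m)
    show ?case
      using generate.eng[OF t Suc] by (simp add: lamp_t_def mult_lamplighter add.commute)
  qed
  have tneg: "(\<lambda>i. 0, - int m) \<in> ?H" for m
  proof (induction m)
    case 0
    show ?case using generate.one[of "lamplighter n"] by (simp add: one_lamplighter)
  next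
    case (Suc m)
    show ?case
      using generate.eng[OF t' Suc] by (simp add: mult_lamplighter)
  qed
  have tk: "(\<lambda>i. 0, k) \<in> ?H" for k :: int
    using tpos[of "nat k"] tneg[of "nat (- k)"] by (cases "k \<ge> 0") auto
  have delta: "((\<lambda>i. if i = k then 1 else 0), 0) \<in> ?H" for k :: int
  proof -
    have "(\<lambda>i. 0, k) \<otimes>\<^bsub>lamplighter n\<^esub> lamp_a \<otimes>\<^bsub>lamplighter n\<^esub> (\<lambda>i. 0, - k)
            = ((\<lambda>i. if i = k then 1 else 0), 0)"
      using assms by (auto simp: lamp_a_def mult_lamplighter fun_eq_iff)
    then show ?thesis
      using generate.eng[OF generate.eng[OF tk a] tk] by metis
  qed
  have deltam: "((\<lambda>i. if i = k then int m mod int n else 0), 0) \<in> ?H" for k :: int and m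
  proof (induction m)
    case 0
    show ?case using generate.one[of "lamplighter n"] by (simp add: one_lamplighter cong: if_cong)
  next
    case (Suc m)
    have "((\<lambda>i. if i = k then 1 else 0), 0)
            \<otimes>\<^bsub>lamplighter n\<^esub> ((\<lambda>i. if i = k then int m mod int n else 0), 0)
          = ((\<lambda>i. if i = k then int (Suc m) mod int n else 0), 0)"
      by (auto simp: mult_lamplighter fun_eq_iff mod_simps)
    then show ?case
      using generate.eng[OF delta Suc] by metis
  qed
  have base: "(f, 0) \<in> ?H"
    if "finite F" "{i. f i \<noteq> 0} \<subseteq> F" "\<forall>i. f i \<in> carrier (integer_mod_group n)" for F f
    using that
  proof (induction F arbitrary: f rule: finite_induct)
    case empty
    then have "f = (\<lambda>i. 0)" by auto
    then show ?case using generate.one[of "lamplighter n"] by (simp add: one_lamplighter)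
  next
    case (insert k F)
    have rng: "0 \<le> f i" "f i < int n" for i
      using insert.prems(2) assms by (auto simp: carrier_integer_mod_group)
    have 1: "(f(k := 0), 0) \<in> ?H"
      using insert.prems by (intro insert.IH) auto
    have 2: "((\<lambda>i. if i = k then f k else 0), 0) \<in> ?H"
      using deltam[of k "nat (f k)"] rng[of k] by (simp cong: if_cong)
    have "(f(k := 0), 0) \<otimes>\<^bsub>lamplighter n\<^esub> ((\<lambda>i. if i = k then f k else 0), 0) = (f, 0)"
      using rng by (auto simp: mult_lamplighter fun_eq_iff)
    then show ?case
      using generate.eng[OF 1 2] by metis
  qed
  show "carrier (lamplighter n) \<subseteq> ?H"
  proof
    fix p assume p: "p \<in> carrier (lamplighter n)"
    obtain f k where fk: "p = (f, k)" by fastforce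
    have f: "\<forall>i. f i \<in> carrier (integer_mod_group n)" "finite {i. f i \<noteq> 0}"
      using p by (auto simp: fk carrier_lamplighter)
    have "(f, 0) \<otimes>\<^bsub>lamplighter n\<^esub> (\<lambda>i. 0, k) = p"
      using f(1) assms by (auto simp: fk mult_lamplighter fun_eq_iff carrier_integer_mod_group)
    then show "p \<in> ?H"
      using generate.eng[OF base[OF f(2) subset_refl f(1)] tk] by metis
  qed
qed

definition T_poly :: "nat \<Rightarrow> real \<Rightarrow> real" where
  "T_poly k x = x ^ (k + 1) - x ^ k - 2 * (\<Sum>j<k. x ^ j)"

definition omega :: "nat \<Rightarrow> real" where
  "omega k = (THE x. x > 0 \<and> T_poly k x = 0)"

end

theory Submission
  imports Defs
begin

text \<open>
  In each of the groups, the elements \<open>t\<^sup>i a t\<^sup>-\<^sup>i\<close> commute with one another, so an element of length at most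
  \<open>N\<close> is \<open>t\<^sup>-\<^sup>p x t\<^sup>q\<close>, where \<open>x\<close> is a product of factors \<open>t\<^sup>i a\<^sup>c t\<^sup>-\<^sup>i\<close> with coefficients \<open>c = c\<^sub>i\<close>,
  \<open>0 \<le> i \<le> L\<close>, such that \<open>L\<close> plus the sum of the \<open>\<bar>c\<^sub>i\<bar>\<close> is at most \<open>N\<close> (\<open>word_normal_form\<close>). The number of
  choices for \<open>p\<close> and \<open>q\<close> is polynomial in \<open>N\<close>, so the growth rate is governed by the possible \<open>x\<close>.

  The coefficient sequences can be brought into a digit expansion that costs no more than the original
  sequence: digits \<open>0, 1\<close> for \<open>L\<^sub>2\<close>, balanced digits \<open>-k, \<dots>, k\<close> for \<open>L\<^sub>2\<^sub>k\<^sub>+\<^sub>1\<close> and \<open>BS(1, 2k+1)\<close> (in the latter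
  with a carry, since \<open>a\<^sup>n = t a t\<^sup>-\<^sup>1\<close>), and non-adjacent digits \<open>0, \<plusminus>1\<close> for \<open>BS(1, 2)\<close>, where every
  nonzero digit is followed by \<open>0\<close>. In all cases the expansion is a sequence of \<^emph>\<open>blocks\<close> \<open>(d, m)\<close>, standing for
  \<open>a\<^sup>d t\<^sup>m\<close> and having weight \<open>\<bar>d\<bar> + m\<close>; only boundedly many leading coefficients, each at most linear in \<open>N\<close>,
  are left over. Conversely, a product of blocks of total weight \<open>N\<close> has length at most \<open>N\<close>, and different
  sequences of blocks of the same total weight give different elements.

  Let \<open>r > 0\<close> be such that the sum of \<open>r\<^sup>-\<^sup>w\<close> over the weights \<open>w\<close> of the blocks is \<open>1\<close>. By the linear
  recurrence for the number of block sequences of total weight \<open>N\<close>, this number lies between two constant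
  multiples of \<open>r\<^sup>N\<close> (\<open>card_words_of_weight_le\<close>, \<open>card_words_of_weight_ge\<close>). Hence the growth rate is \<open>r\<close>
  (\<open>growth_rate_eq\<close>). It remains to exhibit the blocks of each group, and to identify the equation for \<open>r\<close>:
  \<open>1/r + 1/r\<^sup>2 = 1\<close> for \<open>L\<^sub>2\<close>, \<open>T\<^sub>k(r) = 0\<close> for the balanced digits, and \<open>1/r + 2/r\<^sup>3 = 1\<close> for \<open>BS(1, 2)\<close>.
\<close>

section \<open>Weighted words over a finite alphabet\<close>

text \<open>The words over the alphabet \<open>B\<close> of total weight \<open>N\<close>, for a weight function \<open>w\<close> on letters.\<close>

definition words_of_weight :: "('b \<Rightarrow> nat) \<Rightarrow> 'b set \<Rightarrow> nat \<Rightarrow> 'b list set" where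
  "words_of_weight w B N = {bs. set bs \<subseteq> B \<and> sum_list (map w bs) = N}"

lemma words_of_weight_0:
  assumes "\<And>b. b \<in> B \<Longrightarrow> w b > 0"
  shows "words_of_weight w B 0 = {[]}"
proof -
  have "bs = []" if "set bs \<subseteq> B" "sum_list (map w bs) = 0" for bs
    using that assms by (cases bs) fastforce+
  then show ?thesis by (auto simp: words_of_weight_def)
qed

lemma words_of_weight_rec:
  assumes "N > 0"
  shows "words_of_weight w B N
    = (\<Union>b\<in>{b \<in> B. w b \<le> N}. (#) b ` words_of_weight w B (N - w b))" (is "?L = ?R")
proof
  show "?L \<subseteq> ?R"
  proof
    fix bs assume bs: "bs \<in> ?L"
    with assms obtain b bs' where "bs = b # bs'"
      by (cases bs) (auto simp: words_of_weight_def)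
    with bs show "bs \<in> ?R" by (auto simp: words_of_weight_def)
  qed
  show "?R \<subseteq> ?L" by (auto simp: words_of_weight_def)
qed

lemma finite_words_of_weight:
  assumes "finite B" "\<And>b. b \<in> B \<Longrightarrow> w b > 0"
  shows "finite (words_of_weight w B N)"
proof (induction N rule: less_induct)
  case (less N)
  show ?case
  proof (cases "N = 0")
    case True
    then show ?thesis using words_of_weight_0[of B w] assms(2) by simp
  next
    case False
    then have "finite (words_of_weight w B (N - w b))" if "b \<in> B" for b
      using less assms(2)[OF that] by simp
    then show ?thesis using False assms(1) by (simp add: words_of_weight_rec)
  qed
qed

lemma card_words_of_weight_rec:
  assumes "finite B" "\<And>b. b \<in> B \<Longrightarrow> w b > 0" "N > 0"
  shows "card (words_of_weight w B N) = (\<Sum>b | b \<in> B \<and> w b \<le> N. card (words_of_weight w B (N - w b)))"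
  unfolding words_of_weight_rec[OF assms(3)]
  using assms by (subst card_UN_disjoint) (auto simp: finite_words_of_weight card_image)

lemma card_words_of_weight_le:
  fixes r :: real
  assumes "finite B" "\<And>b. b \<in> B \<Longrightarrow> w b > 0" "r > 0" "(\<Sum>b\<in>B. (1 / r) ^ w b) = 1"
  shows "card (words_of_weight w B N) \<le> r ^ N"
proof (induction N rule: less_induct)
  case (less N)
  show ?case
  proof (cases "N = 0")
    case True
    then show ?thesis using words_of_weight_0[of B w] assms(2) by simp
  next
    case False
    have "real (card (words_of_weight w B N))
        = (\<Sum>b | b \<in> B \<and> w b \<le> N. real (card (words_of_weight w B (N - w b))))"
      using False assms(1,2) by (simp add: card_words_of_weight_rec)
    also have "\<dots> \<le> (\<Sum>b | b \<in> B \<and> w b \<le> N. r ^ (N - w b))"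
      using False assms(2) by (intro sum_mono less) auto
    also have "\<dots> = (\<Sum>b | b \<in> B \<and> w b \<le> N. r ^ N * (1 / r) ^ w b)"
      using assms(3) by (intro sum.cong) (auto simp: power_diff power_one_over field_simps)
    also have "\<dots> \<le> (\<Sum>b\<in>B. r ^ N * (1 / r) ^ w b)"
      using assms(1,3) by (intro sum_mono2) auto
    also have "\<dots> = r ^ N" using assms(4) by (simp flip: sum_distrib_left)
    finally show ?thesis .
  qed
qed

lemma card_words_of_weight_ge:
  fixes r :: real
  assumes "finite B" "\<And>b. b \<in> B \<Longrightarrow> w b > 0" "r \<ge> 1" "(\<Sum>b\<in>B. (1 / r) ^ w b) = 1"
    and "b\<^sub>0 \<in> B" "w b\<^sub>0 = 1" "\<And>b. b \<in> B \<Longrightarrow> w b \<le> W"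
  shows "r ^ N \<le> r ^ W * card (words_of_weight w B N)"
proof (induction N rule: less_induct)
  case (less N)
  show ?case
  proof (cases "N \<le> W")
    case True
    \<comment> \<open>Small weights are covered by the letter of weight \<open>1\<close>; for larger ones every letter can come first.\<close>
    have "replicate N b\<^sub>0 \<in> words_of_weight w B N"
      using assms(5,6) by (auto simp: words_of_weight_def sum_list_replicate)
    then have "card (words_of_weight w B N) \<ge> 1"
      using finite_words_of_weight[of B w N] assms(1,2) card_gt_0_iff by (metis One_nat_def Suc_leI empty_iff)
    moreover have "r ^ N \<le> r ^ W" using assms(3) True by (rule power_increasing[rotated])
    moreover have "0 < r ^ W" using assms(3) by simp
    ultimately show ?thesis
      by (smt (verit) mult_le_cancel_left1 of_nat_1 of_nat_mono)
  next
    case False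
    have le: "w b \<le> N" if "b \<in> B" for b
      using assms(7)[OF that] False by simp
    then have eq: "{b \<in> B. w b \<le> N} = B" by blast
    have "r ^ N = (\<Sum>b\<in>B. r ^ N * (1 / r) ^ w b)"
      using assms(4) by (simp flip: sum_distrib_left)
    also have "\<dots> = (\<Sum>b\<in>B. r ^ (N - w b))"
      using assms(3) le by (intro sum.cong) (auto simp: power_diff power_one_over field_simps)
    also have "\<dots> \<le> (\<Sum>b\<in>B. r ^ W * card (words_of_weight w B (N - w b)))"
      using False assms(2) by (intro sum_mono less) auto
    also have "\<dots> = r ^ W * card (words_of_weight w B N)"
      using False assms(1,2) eq by (simp add: card_words_of_weight_rec sum_distrib_left)
    finally show ?thesis .
  qed
qed

text \<open>With \<open>y = 1/r\<close>, the left-hand side increases strictly with \<open>y\<close>; it is \<open>0\<close> at \<open>0\<close> and at least \<open>1\<close> at \<open>1\<close>.\<close>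

lemma ex1_kraft_root:
  assumes "finite B" "B \<noteq> {}" "\<And>b. b \<in> B \<Longrightarrow> w b > 0"
  shows "\<exists>!r::real. r > 0 \<and> (\<Sum>b\<in>B. (1 / r) ^ w b) = 1"
proof -
  let ?g = "\<lambda>y::real. \<Sum>b\<in>B. y ^ w b"
  have "?g 0 = 0" using assms(3) by (intro sum.neutral) auto
  moreover have "1 \<le> ?g 1" using assms(1,2) by (simp add: Suc_leI card_gt_0_iff)
  ultimately obtain y where y: "0 \<le> y" "?g y = 1"
    using IVT'[of ?g 0 1 1] by (force intro!: continuous_intros)
  have "y \<noteq> 0" using y \<open>?g 0 = 0\<close> by auto
  have less: "?g y < ?g z" if "0 < y" "y < z" for y z
    using assms that by (intro sum_strict_mono power_strict_mono) auto
  show ?thesis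
  proof (rule ex1I[of _ "1 / y"])
    show "1 / y > 0 \<and> (\<Sum>b\<in>B. (1 / (1 / y)) ^ w b) = 1" using y \<open>y \<noteq> 0\<close> by simp
    fix r :: real assume r: "r > 0 \<and> ?g (1 / r) = 1"
    then have "1 / r = y"
      using less[of "1 / r" y] less[of y "1 / r"] y \<open>y \<noteq> 0\<close> by (cases "1 / r" y rule: linorder_cases) auto
    then show "r = 1 / y" using r by auto
  qed
qed

lemma root_tendsto_of_bounds:
  fixes f :: "nat \<Rightarrow> real"
  assumes "c > 0" "C > 0" "r > 0"
    and lo: "\<And>n. c * r ^ n \<le> f n" and hi: "\<And>n. f n \<le> C * real (n + 1) ^ q * r ^ n"
  shows "(\<lambda>n. root n (f n)) \<longlonglongrightarrow> r"
proof (rule tendsto_sandwich)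
  show "\<forall>\<^sub>F n in sequentially. root n c * r \<le> root n (f n)"
  proof (rule eventually_sequentiallyI[of 1])
    fix n :: nat assume n: "1 \<le> n"
    have "root n c * r = root n (c * r ^ n)"
      using n assms by (simp add: real_root_mult real_root_power_cancel)
    also have "\<dots> \<le> root n (f n)" using lo n by simp
    finally show "root n c * r \<le> root n (f n)" .
  qed
  show "\<forall>\<^sub>F n in sequentially. root n (f n) \<le> root n C * (root n 2 * root n (real n)) ^ q * r"
  proof (rule eventually_sequentiallyI[of 1])
    fix n :: nat assume n: "1 \<le> n"
    have "f n \<le> C * real (n + 1) ^ q * r ^ n" by (rule hi)
    also have "\<dots> \<le> C * (2 * real n) ^ q * r ^ n"
      using n assms by (intro mult_right_mono mult_left_mono power_mono) auto
    finally have "root n (f n) \<le> root n (C * (2 * real n) ^ q * r ^ n)" using n by simp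
    also have "\<dots> = root n C * (root n 2 * root n (real n)) ^ q * r"
      using n assms by (simp add: real_root_mult real_root_power_cancel real_root_power power_mult_distrib)
    finally show "root n (f n) \<le> root n C * (root n 2 * root n (real n)) ^ q * r" .
  qed
  show "(\<lambda>n. root n c * r) \<longlonglongrightarrow> r"
    using tendsto_mult[OF LIMSEQ_root_const[OF assms(1)] tendsto_const[of r]] by simp
  have "(\<lambda>n. root n C * (root n 2 * root n (real n)) ^ q * r) \<longlonglongrightarrow> 1 * (1 * 1) ^ q * r"
    using assms by (intro tendsto_intros LIMSEQ_root_const LIMSEQ_root) auto
  then show "(\<lambda>n. root n C * (root n 2 * root n (real n)) ^ q * r) \<longlonglongrightarrow> r" by simp
qed

section \<open>Elements of bounded length as shifted products\<close>

text \<open>The number of letters \<open>a\<^sup>\<plusminus>\<^sup>1\<close> needed to write down the coefficients \<open>cs\<close>.\<close>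

definition cost :: "int list \<Rightarrow> nat" where
  "cost cs = sum_list (map (\<lambda>c. nat \<bar>c\<bar>) cs)"

lemma cost_simps [simp]:
  "cost [] = 0" "cost (c # cs) = nat \<bar>c\<bar> + cost cs" "cost (cs @ cs') = cost cs + cost cs'"
  by (simp_all add: cost_def)

lemma abs_le_cost: "c \<in> set cs \<Longrightarrow> nat \<bar>c\<bar> \<le> cost cs"
  by (induction cs) auto

text \<open>A block \<open>(d, m)\<close> stands for \<open>a\<^sup>d t\<^sup>m\<close>; its weight is the length of this word.\<close>

definition block_weight :: "int \<times> nat \<Rightarrow> nat" where
  "block_weight b = nat \<bar>fst b\<bar> + snd b"

lemma (in group) foldr_mult_append:
  assumes "set us \<subseteq> carrier G" "set vs \<subseteq> carrier G"
  shows "foldr (\<otimes>) (us @ vs) \<one> = foldr (\<otimes>) us \<one> \<otimes> foldr (\<otimes>) vs \<one>"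
proof -
  have closed: "foldr (\<otimes>) xs \<one> \<in> carrier G" if "set xs \<subseteq> carrier G" for xs
    using that by (induction xs) auto
  show "foldr (\<otimes>) (us @ vs) \<one> = foldr (\<otimes>) us \<one> \<otimes> foldr (\<otimes>) vs \<one>"
    using assms by (induction us) (auto simp: closed m_assoc)
qed

lemma (in group) foldr_mult_replicate:
  assumes "x \<in> carrier G"
  shows "foldr (\<otimes>) (replicate k x) \<one> = x [^] k"
proof (induction k)
  case (Suc k)
  have "foldr (\<otimes>) (replicate (Suc k) x) \<one> = x \<otimes> x [^] k"
    by (simp only: replicate_Suc foldr.simps o_apply Suc)
  also have "\<dots> = x [^] Suc k" by (rule nat_pow_Suc2[OF assms, symmetric])
  finally show ?case .
qed simp

lemma (in group) generate_imp_word: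
  assumes "S \<subseteq> carrier G" "g \<in> generate G S"
  shows "\<exists>ws. set ws \<subseteq> S \<union> m_inv G ` S \<and> foldr (\<otimes>) ws \<one> = g"
  using assms(2)
proof induction
  case one
  show ?case by (rule exI[of _ "[]"]) simp
next
  case (incl h)
  then show ?case using assms(1) by (intro exI[of _ "[h]"]) auto
next
  case (inv h)
  then show ?case using assms(1) by (intro exI[of _ "[inv h]"]) auto
next
  case (eng g h)
  then obtain us vs where uv: "set us \<subseteq> S \<union> m_inv G ` S" "foldr (\<otimes>) us \<one> = g"
    "set vs \<subseteq> S \<union> m_inv G ` S" "foldr (\<otimes>) vs \<one> = h" by blast
  then have "set us \<subseteq> carrier G" "set vs \<subseteq> carrier G" using assms(1) by auto
  with uv show ?case by (intro exI[of _ "us @ vs"]) (auto simp: foldr_mult_append simp del: foldr_append)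
qed

lemma word_length_le:
  assumes "set ws \<subseteq> S \<union> m_inv G ` S" "foldr (\<otimes>\<^bsub>G\<^esub>) ws \<one>\<^bsub>G\<^esub> = g"
  shows "word_length G S g \<le> length ws"
  unfolding word_length_def using assms by (intro Least_le) blast

lemma (in group) obtain_shortest_word:
  assumes "S \<subseteq> carrier G" "g \<in> generate G S"
  obtains ws where "set ws \<subseteq> S \<union> m_inv G ` S" "length ws = word_length G S g"
    "foldr (\<otimes>) ws \<one> = g"
proof -
  have "\<exists>m ws. set ws \<subseteq> S \<union> m_inv G ` S \<and> length ws = m \<and> foldr (\<otimes>) ws \<one> = g"
    using generate_imp_word[OF assms] by blast
  from LeastI_ex[OF this] show ?thesis
    using that unfolding word_length_def by blast
qed

text \<open>A group generated by \<open>a\<close> and \<open>t\<close> in which the conjugates of powers of \<open>a\<close> by powers of \<open>t\<close> commute with the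
  powers of \<open>a\<close>, hence with one another.\<close>

locale shift_group = group G for G (structure) +
  fixes a t :: 'a
  assumes a_closed [simp]: "a \<in> carrier G" and t_closed [simp]: "t \<in> carrier G"
    and generate_at: "generate G {a, t} = carrier G"
    and conj_commute: "\<And>(p::nat) (i::int) (j::int).
      (t [^] p \<otimes> a [^] i \<otimes> inv (t [^] p)) \<otimes> a [^] j = a [^] j \<otimes> (t [^] p \<otimes> a [^] i \<otimes> inv (t [^] p))"
begin

lemma cancel_left [simp]:
  assumes "x \<in> carrier G" "y \<in> carrier G"
  shows "x \<otimes> (inv x \<otimes> y) = y" "inv x \<otimes> (x \<otimes> y) = y"
  using assms by (simp_all flip: m_assoc)

text \<open>The product of the \<open>t\<^sup>i a\<^sup>c t\<^sup>-\<^sup>i\<close> for the coefficients \<open>c = cs ! i\<close>, in Horner form.\<close>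

primrec shift_prod :: "int list \<Rightarrow> 'a" where
  "shift_prod [] = \<one>"
| "shift_prod (c # cs) = a [^] c \<otimes> (t \<otimes> shift_prod cs \<otimes> inv t)"

text \<open>The product of the \<open>a\<^sup>d t\<^sup>m\<close> for the blocks \<open>(d, m)\<close> of a list.\<close>

primrec block_prod :: "(int \<times> nat) list \<Rightarrow> 'a" where
  "block_prod [] = \<one>"
| "block_prod (b # bs) = a [^] fst b \<otimes> t [^] snd b \<otimes> block_prod bs"

lemma shift_prod_closed [simp]: "shift_prod cs \<in> carrier G"
  by (induction cs) auto

lemma block_prod_closed [simp]: "block_prod bs \<in> carrier G"
  by (induction bs) auto

lemma shift_prod_append_0 [simp]: "shift_prod (cs @ [0]) = shift_prod cs"
  by (induction cs) auto

lemma t_pow_commute: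
  fixes k :: nat
  shows "t \<otimes> t [^] k = t [^] k \<otimes> t" "inv (t [^] k) \<otimes> inv t = inv t \<otimes> inv (t [^] k)"
proof -
  show *: "t \<otimes> t [^] k = t [^] k \<otimes> t"
    using nat_pow_comm[of t 1 k] by simp
  show "inv (t [^] k) \<otimes> inv t = inv t \<otimes> inv (t [^] k)"
    by (metis * inv_mult_group nat_pow_closed t_closed)
qed

lemma t_pow_left_commute:
  fixes k :: nat
  assumes "x \<in> carrier G"
  shows "t \<otimes> (t [^] k \<otimes> x) = t [^] k \<otimes> (t \<otimes> x)"
    "inv (t [^] k) \<otimes> (inv t \<otimes> x) = inv t \<otimes> (inv (t [^] k) \<otimes> x)"
  using assms t_pow_commute[of k] by (metis m_assoc inv_closed nat_pow_closed t_closed)+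

lemma shift_prod_zeros:
  assumes "m > 0"
  shows "shift_prod (d # replicate (m - 1) 0 @ cs) = a [^] d \<otimes> (t [^] m \<otimes> shift_prod cs \<otimes> inv (t [^] m))"
proof -
  have "shift_prod (replicate k 0 @ cs) = t [^] k \<otimes> shift_prod cs \<otimes> inv (t [^] k)" for k
    by (induction k) (simp_all add: t_pow_commute t_pow_left_commute m_assoc inv_mult_group)
  then show ?thesis
    using assms by (cases m) (simp_all add: t_pow_commute t_pow_left_commute m_assoc inv_mult_group)
qed

text \<open>Multiplication by \<open>t\<^sup>p a\<^sup>s t\<^sup>-\<^sup>p\<close> changes the coefficient number \<open>p\<close>.\<close>

lemma shift_prod_add:
  assumes "p < length cs"
  shows "\<exists>cs'. length cs' = length cs \<and> cost cs' \<le> cost cs + nat \<bar>s\<bar> \<and>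
    t [^] p \<otimes> a [^] s \<otimes> inv (t [^] p) \<otimes> shift_prod cs = shift_prod cs'"
  using assms
proof (induction p arbitrary: cs)
  case 0
  then obtain c cs\<^sub>0 where cs: "cs = c # cs\<^sub>0" by (cases cs) auto
  show ?case
    by (rule exI[of _ "(s + c) # cs\<^sub>0"]) (auto simp: cs int_pow_mult m_assoc)
next
  case (Suc p)
  then obtain c cs\<^sub>0 where cs: "cs = c # cs\<^sub>0" "p < length cs\<^sub>0" by (cases cs) auto
  from Suc.IH[OF cs(2)] obtain cs' where cs': "length cs' = length cs\<^sub>0" "cost cs' \<le> cost cs\<^sub>0 + nat \<bar>s\<bar>"
    "t [^] p \<otimes> a [^] s \<otimes> inv (t [^] p) \<otimes> shift_prod cs\<^sub>0 = shift_prod cs'" by blast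
  let ?x = "t [^] p \<otimes> a [^] s \<otimes> inv (t [^] p)"
  have x: "?x \<in> carrier G" by simp
  have eq: "t [^] Suc p \<otimes> a [^] s \<otimes> inv (t [^] Suc p) = t \<otimes> ?x \<otimes> inv t"
    by (simp add: t_pow_commute t_pow_left_commute m_assoc inv_mult_group)
  have "t [^] Suc p \<otimes> a [^] s \<otimes> inv (t [^] Suc p) \<otimes> shift_prod cs
      = (t [^] Suc p \<otimes> a [^] s \<otimes> inv (t [^] Suc p) \<otimes> a [^] c) \<otimes> (t \<otimes> shift_prod cs\<^sub>0 \<otimes> inv t)"
    by (simp add: cs m_assoc del: nat_pow_Suc)
  also have "\<dots> = a [^] c \<otimes> (t \<otimes> ?x \<otimes> inv t) \<otimes> (t \<otimes> shift_prod cs\<^sub>0 \<otimes> inv t)"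
    unfolding eq[symmetric] conj_commute ..
  also have "\<dots> = a [^] c \<otimes> (t \<otimes> (?x \<otimes> shift_prod cs\<^sub>0) \<otimes> inv t)"
    using x by (simp add: m_assoc)
  also have "\<dots> = shift_prod (c # cs')" using cs'(3) by simp
  finally show ?case
    using cs cs' by (intro exI[of _ "c # cs'"]) auto
qed

text \<open>The path of the exponent of \<open>t\<close> along the word visits \<open>length cs\<close> consecutive values; the list
  \<open>cs\<close> starts at the lowest one, \<open>p\<close> is the starting point and \<open>q\<close> the endpoint, relative to it.\<close>

lemma word_normal_form:
  assumes "set ws \<subseteq> {a, t} \<union> m_inv G ` {a, t}"
  shows "\<exists>cs p q. p < length cs \<and> q < length cs \<and> cost cs + length cs \<le> length ws + 1 \<and>
    foldr (\<otimes>) ws \<one> = inv (t [^] p) \<otimes> shift_prod cs \<otimes> t [^] (q::nat)"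
  using assms
proof (induction ws)
  case Nil
  show ?case by (intro exI[of _ "[0]"] exI[of _ "0::nat"]) auto
next
  case (Cons w ws)
  then obtain cs p and q :: nat where
    IH: "p < length cs" "q < length cs" "cost cs + length cs \<le> length ws + 1"
      "foldr (\<otimes>) ws \<one> = inv (t [^] p) \<otimes> shift_prod cs \<otimes> t [^] q" by auto
  have a_power: ?case if w: "w = a [^] s" "\<bar>s\<bar> = 1" for s :: int
  proof -
    obtain cs' where cs': "length cs' = length cs" "cost cs' \<le> cost cs + nat \<bar>s\<bar>"
      "t [^] p \<otimes> a [^] s \<otimes> inv (t [^] p) \<otimes> shift_prod cs = shift_prod cs'"
      using shift_prod_add[OF IH(1)] by blast
    have "inv (t [^] p) \<otimes> shift_prod cs' \<otimes> t [^] q = foldr (\<otimes>) (w # ws) \<one>"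
      unfolding cs'(3)[symmetric] by (simp add: w IH m_assoc)
    then show ?thesis
      using cs' IH w by (intro exI[of _ cs'] exI[of _ p] exI[of _ q]) auto
  qed
  from Cons.prems consider "w = a" | "w = inv a" | "w = t" | "w = inv t" by auto
  then show ?case
  proof cases
    case 1
    then show ?thesis using a_power[of 1] by (simp add: int_pow_1)
  next
    case 2
    then show ?thesis using a_power[of "-1"] by (simp add: int_pow_neg int_pow_1)
  next
    case 3
    show ?thesis
    proof (cases p)
      case 0
      have "foldr (\<otimes>) (w # ws) \<one> = t \<otimes> shift_prod cs \<otimes> inv t \<otimes> (t \<otimes> t [^] q)"
        using IH(4) 3 0 by (simp add: m_assoc)
      then have "foldr (\<otimes>) (w # ws) \<one> = inv (t [^] (0::nat)) \<otimes> shift_prod (0 # cs) \<otimes> t [^] Suc q"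
        by (simp add: t_pow_commute)
      then show ?thesis
        using IH by (intro exI[of _ "0 # cs"] exI[of _ "0::nat"] exI[of _ "Suc q"]) auto
    next
      case (Suc p')
      have "foldr (\<otimes>) (w # ws) \<one> = inv (t [^] p') \<otimes> shift_prod cs \<otimes> t [^] q"
        using IH(4) 3 by (simp add: Suc m_assoc inv_mult_group)
      then show ?thesis
        using IH Suc by (intro exI[of _ cs] exI[of _ p'] exI[of _ q]) auto
    qed
  next
    case 4
    have eq: "foldr (\<otimes>) (w # ws) \<one> = inv (t [^] Suc p) \<otimes> shift_prod (cs @ [0]) \<otimes> t [^] q"
      using IH(4) 4 by (simp add: m_assoc inv_mult_group)
    show ?thesis
      using IH eq by (intro exI[of _ "cs @ [0]"] exI[of _ "Suc p"] exI[of _ q]) auto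
  qed
qed

lemma block_prod_word:
  "\<exists>ws. set ws \<subseteq> {a, t} \<union> m_inv G ` {a, t} \<and> length ws = sum_list (map block_weight bs) \<and>
    foldr (\<otimes>) ws \<one> = block_prod bs"
proof (induction bs)
  case Nil
  show ?case by simp
next
  case (Cons b bs)
  then obtain ws where ws: "set ws \<subseteq> {a, t} \<union> m_inv G ` {a, t}"
    "length ws = sum_list (map block_weight bs)" "foldr (\<otimes>) ws \<one> = block_prod bs" by blast
  let ?d = "fst b" and ?m = "snd b"
  let ?us = "replicate (nat \<bar>?d\<bar>) (if ?d \<ge> 0 then a else inv a)"
  have "foldr (\<otimes>) ?us \<one> = (if ?d \<ge> 0 then a else inv a) [^] nat \<bar>?d\<bar>"
    by (rule foldr_mult_replicate) simp
  also have "\<dots> = a [^] ?d"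
    using nat_pow_inv[OF a_closed, of "nat (- ?d)"] by (auto simp only: int_pow_def2 split: if_split) auto
  finally have "foldr (\<otimes>) ?us \<one> = a [^] ?d" .
  moreover have "foldr (\<otimes>) (replicate ?m t @ ws) \<one> = t [^] ?m \<otimes> block_prod bs"
    using ws by (subst foldr_mult_append) (auto simp: foldr_mult_replicate simp del: foldr_append foldr_replicate)
  moreover have "foldr (\<otimes>) (?us @ (replicate ?m t @ ws)) \<one>
      = foldr (\<otimes>) ?us \<one> \<otimes> foldr (\<otimes>) (replicate ?m t @ ws) \<one>"
    using ws(1) by (intro foldr_mult_append) auto
  ultimately have "foldr (\<otimes>) (?us @ replicate ?m t @ ws) \<one> = block_prod (b # bs)"
    by (simp add: m_assoc)
  then show ?case
    using ws(1,2) by (intro exI[of _ "?us @ replicate ?m t @ ws"]) (auto simp: block_weight_def[of b] simp del: foldr_append foldr_replicate)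
qed

end

section \<open>Growth rates from systems of blocks\<close>

lemma card_bounded_lists:
  "real (card {cs. set cs \<subseteq> {- int (N + 1)..int (N + 1)} \<and> length cs \<le> K})
    \<le> (real K + 1) * (3 * real (N + 1)) ^ K"
proof -
  have "card {- int (N + 1)..int (N + 1)} = 2 * N + 3" by simp
  then have "card {cs. set cs \<subseteq> {- int (N + 1)..int (N + 1)} \<and> length cs \<le> K} = (\<Sum>i\<le>K. (2 * N + 3) ^ i)"
    using card_lists_length_le[of "{- int (N + 1)..int (N + 1)}" K] by (simp only: finite_atLeastAtMost_int)
  then have "real (card {cs. set cs \<subseteq> {- int (N + 1)..int (N + 1)} \<and> length cs \<le> K})
      = (\<Sum>i\<le>K. real (2 * N + 3) ^ i)" by (simp only: of_nat_sum of_nat_power)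
  also have "\<dots> \<le> (\<Sum>i\<le>K. (3 * real (N + 1)) ^ K)"
  proof (rule sum_mono)
    fix i assume "i \<in> {..K}"
    have "real (2 * N + 3) ^ i \<le> (3 * real (N + 1)) ^ i" by (rule power_mono) auto
    also have "\<dots> \<le> (3 * real (N + 1)) ^ K" using \<open>i \<in> {..K}\<close> by (intro power_increasing) auto
    finally show "real (2 * N + 3) ^ i \<le> (3 * real (N + 1)) ^ K" .
  qed
  also have "\<dots> = (real K + 1) * (3 * real (N + 1)) ^ K"
    by (simp only: sum_constant card_atMost) simp
  finally show ?thesis .
qed

lemma growth_bound_arith:
  fixes x c l r p :: real
  assumes "c \<le> (2 * x) * (r * p)" "l \<le> m * (3 * x) ^ K" "0 \<le> x" "0 \<le> l" "0 \<le> r" "0 \<le> p"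
  shows "x * (c * (l * x)) \<le> (2 * r * m * 3 ^ K) * x ^ (K + 3) * p"
proof -
  have "x * (c * (l * x)) \<le> x * (((2 * x) * (r * p)) * ((m * (3 * x) ^ K) * x))"
    using assms by (intro mult_left_mono mult_mono mult_right_mono) simp_all
  also have "\<dots> = (2 * r * m * 3 ^ K) * x ^ (K + 3) * p"
    by (simp add: power_add power3_eq_cube power_mult_distrib mult_ac)
  finally show ?thesis .
qed

text \<open>A system \<open>B\<close> of blocks for which \<open>r\<close> is the growth rate of block sequences. By \<open>reduce\<close>, every list of more
  than \<open>K\<close> coefficients can be changed, without increasing the cost, so that it begins with a block
  (a digit \<open>d\<close> and \<open>m - 1\<close> zeros). By \<open>unique_block\<close>, a product of blocks determines its first block.\<close>

locale block_system = shift_group +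
  fixes B :: "(int \<times> nat) set" and K :: nat and r :: real
  assumes finite_B: "finite B" and block_pos: "(d, m) \<in> B \<Longrightarrow> m > 0" and zero_block: "(0, 1) \<in> B"
    and r_pos: "r > 0" and kraft: "(\<Sum>b\<in>B. (1 / r) ^ block_weight b) = 1"
    and reduce: "length cs > K \<Longrightarrow> \<exists>d m cs'. (d, m) \<in> B \<and> length cs = m + length cs' \<and>
      nat \<bar>d\<bar> + cost cs' \<le> cost cs \<and> shift_prod cs = shift_prod (d # replicate (m - 1) 0 @ cs')"
    and unique_block: "\<lbrakk>b \<in> B; b' \<in> B; set bs \<subseteq> B; set bs' \<subseteq> B;
      block_prod (b # bs) = block_prod (b' # bs')\<rbrakk> \<Longrightarrow> b = b'"
begin

lemma block_weight_pos: "b \<in> B \<Longrightarrow> block_weight b > 0"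
  using block_pos by (cases b) (auto simp: block_weight_def)

lemma r_ge_1: "r \<ge> 1"
proof -
  have "(1 / r) ^ block_weight (0, 1) \<le> (\<Sum>b\<in>B. (1 / r) ^ block_weight b)"
    using finite_B zero_block r_pos by (intro member_le_sum) auto
  then show ?thesis using kraft r_pos by (simp add: block_weight_def field_simps)
qed

abbreviation coded :: "nat \<Rightarrow> (int \<times> nat) list set" where
  "coded \<equiv> words_of_weight block_weight B"

lemma finite_coded: "finite (coded N)"
  using finite_words_of_weight finite_B block_weight_pos by blast

lemma block_prod_inj:
  assumes "set bs \<subseteq> B" "set bs' \<subseteq> B" "sum_list (map block_weight bs) = sum_list (map block_weight bs')"
    and "block_prod bs = block_prod bs'"
  shows "bs = bs'"
  using assms
proof (induction bs arbitrary: bs')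
  case Nil
  show ?case
  proof (cases bs')
    case (Cons b' bs'')
    then show ?thesis using Nil.prems(2,3) block_weight_pos[of b'] by simp
  qed simp
next
  case (Cons b bs)
  have "sum_list (map block_weight bs') > 0"
    using Cons.prems(1,3) block_weight_pos[of b] by simp
  then obtain b' bs'' where bs': "bs' = b' # bs''" by (cases bs') auto
  have "b = b'"
  proof (rule unique_block)
    show "block_prod (b # bs) = block_prod (b' # bs'')" using Cons.prems(4) unfolding bs' .
  qed (use Cons.prems(1,2) bs' in auto)
  moreover have "block_prod bs = block_prod bs''"
    using Cons.prems(4) \<open>b = b'\<close> bs' by simp
  ultimately show ?case using Cons.IH[of bs''] Cons.prems(1-3) bs' by auto
qed

text \<open>Splitting off blocks as long as more than \<open>K\<close> coefficients remain.\<close>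

lemma shift_prod_reduce:
  "\<exists>bs cs' s. set bs \<subseteq> B \<and> length cs' \<le> K \<and>
    sum_list (map block_weight bs) + cost cs' \<le> cost cs + length cs \<and>
    s = sum_list (map snd bs) \<and>
    shift_prod cs = block_prod bs \<otimes> shift_prod cs' \<otimes> inv (t [^] s)"
proof (induction cs rule: length_induct)
  case (1 cs)
  show ?case
  proof (cases "length cs \<le> K")
    case True
    then show ?thesis by (intro exI[of _ "[]"] exI[of _ cs]) auto
  next
    case False
    then obtain d m cs\<^sub>1 where 2: "(d, m) \<in> B" "length cs = m + length cs\<^sub>1"
      "nat \<bar>d\<bar> + cost cs\<^sub>1 \<le> cost cs" "shift_prod cs = shift_prod (d # replicate (m - 1) 0 @ cs\<^sub>1)"
      using reduce[of cs] by auto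
    from 2 block_pos have m: "m > 0" by blast
    then obtain bs cs' s where 3: "set bs \<subseteq> B" "length cs' \<le> K"
      "sum_list (map block_weight bs) + cost cs' \<le> cost cs\<^sub>1 + length cs\<^sub>1"
      "s = sum_list (map snd bs)"
      "shift_prod cs\<^sub>1 = block_prod bs \<otimes> shift_prod cs' \<otimes> inv (t [^] s)"
      using 1 2(2) by (metis add.commute less_add_same_cancel1)
    have "shift_prod cs = a [^] d \<otimes> (t [^] m \<otimes> (block_prod bs \<otimes> shift_prod cs' \<otimes> inv (t [^] s)) \<otimes> inv (t [^] m))"
      using 2(4) 3(5) shift_prod_zeros[OF m] by simp
    also have "\<dots> = block_prod ((d, m) # bs) \<otimes> shift_prod cs' \<otimes> inv (t [^] (m + s))"
      by (simp add: m_assoc inv_mult_group flip: nat_pow_mult)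
    finally show ?thesis
      using 2 3 by (intro exI[of _ "(d, m) # bs"] exI[of _ cs'] exI[of _ "m + s"])
        (auto simp: block_weight_def[of "(d, m)"])
  qed
qed

abbreviation ball :: "nat \<Rightarrow> 'a set" where
  "ball N \<equiv> {g \<in> carrier G. word_length G {a, t} g \<le> N}"

text \<open>An element of length at most \<open>N\<close> is given by two exponents, a block sequence and at most \<open>K\<close> bounded
  coefficients. The bounds are \<open>N + 1\<close> because a list of coefficients is one longer than the path along it.\<close>

lemma ball_subset:
  "ball N \<subseteq> (\<lambda>(p, bs, cs, q).
      inv (t [^] p) \<otimes> (block_prod bs \<otimes> shift_prod cs \<otimes> inv (t [^] sum_list (map snd bs))) \<otimes> t [^] q)
    ` ({..N} \<times> (\<Union>i\<le>N + 1. coded i) \<times> {cs. set cs \<subseteq> {- int (N + 1)..int (N + 1)} \<and> length cs \<le> K} \<times> {..N})"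
    (is "_ \<subseteq> ?f ` ?P")
proof
  fix g assume g: "g \<in> ball N"
  have "{a, t} \<subseteq> carrier G" "g \<in> generate G {a, t}"
    using g generate_at by auto
  then obtain ws where ws: "set ws \<subseteq> {a, t} \<union> m_inv G ` {a, t}"
    "length ws = word_length G {a, t} g" "foldr (\<otimes>) ws \<one> = g"
    by (rule obtain_shortest_word)
  obtain cs p and q :: nat where cs: "p < length cs" "q < length cs"
    "cost cs + length cs \<le> length ws + 1" "g = inv (t [^] p) \<otimes> shift_prod cs \<otimes> t [^] q"
    using word_normal_form[OF ws(1)] ws(3) by auto
  obtain bs cs' where bs: "set bs \<subseteq> B" "length cs' \<le> K"
    "sum_list (map block_weight bs) + cost cs' \<le> cost cs + length cs"
    "shift_prod cs = block_prod bs \<otimes> shift_prod cs' \<otimes> inv (t [^] sum_list (map snd bs))"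
    using shift_prod_reduce[of cs] by blast
  have N: "length ws \<le> N" using g ws by simp
  have "c \<in> {- int (N + 1)..int (N + 1)}" if "c \<in> set cs'" for c
    using abs_le_cost[OF that] bs(3) cs(3) N by auto
  moreover have "bs \<in> (\<Union>i\<le>N + 1. coded i)"
    using bs(1,3) cs(3) N by (auto simp: words_of_weight_def)
  ultimately have "(p, bs, cs', q) \<in> ?P"
    using cs(1-3) bs(2) N by auto
  then show "g \<in> ?f ` ?P"
    using cs(4) bs(4) by (intro image_eqI[of _ _ "(p, bs, cs', q)"]) auto
qed

lemma card_coded_upto: "real (card (\<Union>i\<le>N + 1. coded i)) \<le> (2 * real (N + 1)) * (r * r ^ N)"
proof -
  have "card (\<Union>i\<le>N + 1. coded i) \<le> (\<Sum>i\<le>N + 1. card (coded i))"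
    by (rule card_UN_le) simp
  then have "real (card (\<Union>i\<le>N + 1. coded i)) \<le> (\<Sum>i\<le>N + 1. real (card (coded i)))"
    by (simp only: of_nat_le_iff flip: of_nat_sum)
  also have "\<dots> \<le> (\<Sum>i\<le>N + 1. r ^ (N + 1))"
  proof (rule sum_mono)
    fix i assume "i \<in> {..N + 1}"
    then have "r ^ i \<le> r ^ (N + 1)" using r_ge_1 by (intro power_increasing) auto
    then show "real (card (coded i)) \<le> r ^ (N + 1)"
      using card_words_of_weight_le[OF finite_B block_weight_pos r_pos kraft, of i] by linarith
  qed
  also have "\<dots> = real (N + 2) * r ^ (N + 1)" by (simp only: sum_constant card_atMost) simp
  also have "\<dots> \<le> (2 * real (N + 1)) * r ^ (N + 1)"
    using r_pos by (intro mult_right_mono) auto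
  finally show ?thesis by simp
qed

lemma growth_function_upper:
  "finite (ball N)"
  "real (growth_function G {a, t} N) \<le> (2 * r * (real K + 1) * 3 ^ K) * real (N + 1) ^ (K + 3) * r ^ N"
proof -
  define L where "L = {cs. set cs \<subseteq> {- int (N + 1)..int (N + 1)} \<and> length cs \<le> K}"
  define C where "C = (\<Union>i\<le>N + 1. coded i)"
  let ?P = "{..N} \<times> C \<times> L \<times> {..N}"
  note ball_subset' = ball_subset[of N, folded L_def C_def]
  have "finite L" unfolding L_def by (rule finite_lists_length_le) simp
  moreover have "finite C" unfolding C_def using finite_coded by blast
  ultimately have fin: "finite ?P" by blast
  show "finite (ball N)"
    by (rule finite_subset[OF ball_subset']) (intro finite_imageI fin)
  have "growth_function G {a, t} N \<le> card ?P"
    unfolding growth_function_def by (rule surj_card_le[OF fin ball_subset'])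
  also have "\<dots> = (N + 1) * (card C * (card L * (N + 1)))"
    by (simp only: card_cartesian_product card_atMost Suc_eq_plus1)
  finally have "real (growth_function G {a, t} N) \<le> real ((N + 1) * (card C * (card L * (N + 1))))"
    by (simp only: of_nat_le_iff)
  also have "\<dots> = real (N + 1) * (real (card C) * (real (card L) * real (N + 1)))"
    by (simp only: of_nat_mult)
  also have "\<dots> \<le> (2 * r * (real K + 1) * 3 ^ K) * real (N + 1) ^ (K + 3) * r ^ N"
    using card_coded_upto[of N, folded C_def] card_bounded_lists[of N K, folded L_def] r_pos
    by (intro growth_bound_arith) simp_all
  finally show "real (growth_function G {a, t} N)
      \<le> (2 * r * (real K + 1) * 3 ^ K) * real (N + 1) ^ (K + 3) * r ^ N" .
qed

lemma growth_function_lower: "card (coded N) \<le> growth_function G {a, t} N"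
proof -
  have "block_prod ` coded N \<subseteq> ball N"
  proof
    fix g assume "g \<in> block_prod ` coded N"
    then obtain bs where bs: "g = block_prod bs" "sum_list (map block_weight bs) = N"
      by (auto simp: words_of_weight_def)
    moreover obtain ws where ws: "set ws \<subseteq> {a, t} \<union> m_inv G ` {a, t}"
      "length ws = sum_list (map block_weight bs)" "foldr (\<otimes>) ws \<one> = block_prod bs"
      using block_prod_word by blast
    ultimately show "g \<in> ball N"
      using word_length_le[OF ws(1,3)] by simp
  qed
  then have "card (block_prod ` coded N) \<le> growth_function G {a, t} N"
    unfolding growth_function_def by (rule card_mono[OF growth_function_upper(1)])
  moreover have "card (block_prod ` coded N) = card (coded N)"
  proof (rule card_image, rule inj_onI)
    fix bs bs' assume "bs \<in> coded N" "bs' \<in> coded N" "block_prod bs = block_prod bs'"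
    then show "bs = bs'"
      unfolding words_of_weight_def by (intro block_prod_inj) auto
  qed
  ultimately show ?thesis by simp
qed

theorem growth_rate_eq: "growth_rate G {a, t} = r"
proof -
  define W where "W = Max (block_weight ` B)"
  have W: "block_weight b \<le> W" if "b \<in> B" for b
    unfolding W_def using that finite_B by simp
  have "block_weight (0, 1) = 1" by (simp add: block_weight_def)
  then have "r ^ N \<le> r ^ W * card (coded N)" for N
    using card_words_of_weight_ge[OF finite_B block_weight_pos r_ge_1 kraft zero_block _ W] by blast
  then have card: "1 / r ^ W * r ^ N \<le> real (card (coded N))" for N
    using r_pos by (simp add: field_simps)
  have lower: "1 / r ^ W * r ^ N \<le> real (growth_function G {a, t} N)" for N
    using card[of N] growth_function_lower[of N] by linarith
  have "(\<lambda>N. root N (real (growth_function G {a, t} N))) \<longlonglongrightarrow> r"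
  proof (rule root_tendsto_of_bounds)
    show "0 < 1 / r ^ W" "0 < 2 * r * (real K + 1) * 3 ^ K" "0 < r" using r_pos by simp_all
    show "1 / r ^ W * r ^ N \<le> real (growth_function G {a, t} N)" for N by (rule lower)
    show "real (growth_function G {a, t} N) \<le> 2 * r * (real K + 1) * 3 ^ K * real (N + 1) ^ (K + 3) * r ^ N" for N
      by (rule growth_function_upper(2))
  qed
  then show ?thesis
    unfolding growth_rate_def by (rule limI)
qed

end

section \<open>Lamplighter groups\<close>

lemma lamp_a_carrier: "n \<ge> 2 \<Longrightarrow> lamp_a \<in> carrier (lamplighter n)"
  by (auto simp: carrier_lamplighter carrier_integer_mod_group lamp_a_def)

lemma lamp_t_carrier: "n \<ge> 2 \<Longrightarrow> lamp_t \<in> carrier (lamplighter n)"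
  by (auto simp: carrier_lamplighter carrier_integer_mod_group lamp_t_def)

lemma lamp_a_int_pow:
  fixes c :: int
  assumes "n \<ge> 2"
  shows "lamp_a [^]\<^bsub>lamplighter n\<^esub> c = ((\<lambda>i. if i = 0 then c mod int n else 0), 0)"
proof -
  interpret G: group "lamplighter n" by (rule group_lamplighter)
  have pow: "lamp_a [^]\<^bsub>lamplighter n\<^esub> m = ((\<lambda>i. if i = 0 then int m mod int n else 0), 0)" for m :: nat
  proof (induction m)
    case 0
    show ?case by (simp add: one_lamplighter cong: if_cong)
  next
    case (Suc m)
    then show ?case
      by (auto simp: lamp_a_def mult_lamplighter fun_eq_iff mod_simps add.commute)
  qed
  have inv_pow: "inv\<^bsub>lamplighter n\<^esub> (lamp_a [^]\<^bsub>lamplighter n\<^esub> m)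
      = ((\<lambda>i. if i = 0 then (- int m) mod int n else 0), 0)" for m :: nat
    using assms lamp_a_carrier[OF assms]
    by (intro G.inv_equality) (auto simp: pow one_lamplighter mult_lamplighter mod_simps
        carrier_lamplighter carrier_integer_mod_group)
  show ?thesis
  proof (cases "c < 0")
    case True
    then have "int (nat (- c)) = - c" by simp
    with True show ?thesis unfolding int_pow_def2 inv_pow by (simp only: minus_minus if_True)
  next
    case False
    then have "int (nat c) = c" by simp
    with False show ?thesis unfolding int_pow_def2 pow by (simp only: if_False)
  qed
qed

lemma lamp_t_nat_pow: "lamp_t [^]\<^bsub>lamplighter n\<^esub> (p::nat) = (\<lambda>i. 0, int p)"
  by (induction p) (simp_all add: one_lamplighter lamp_t_def mult_lamplighter)

lemma inv_lamp_t_nat_pow: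
  assumes "n \<ge> 2"
  shows "inv\<^bsub>lamplighter n\<^esub> (lamp_t [^]\<^bsub>lamplighter n\<^esub> (p::nat)) = (\<lambda>i. 0, - int p)"
  using assms by (intro group.inv_equality[OF group_lamplighter])
    (auto simp: lamp_t_nat_pow one_lamplighter mult_lamplighter carrier_lamplighter carrier_integer_mod_group)

lemma shift_group_lamplighter:
  assumes "n \<ge> 2"
  shows "shift_group (lamplighter n) lamp_a lamp_t"
proof -
  interpret G: group "lamplighter n" by (rule group_lamplighter)
  show ?thesis
    using assms
    by unfold_locales
      (auto simp: lamp_a_carrier lamp_t_carrier generate_lamplighter lamp_a_int_pow
        inv_lamp_t_nat_pow mult_lamplighter, auto simp: lamp_t_nat_pow mult_lamplighter fun_eq_iff mod_simps add.commute)
qed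

text \<open>Here all blocks have the form \<open>(d, 1)\<close>. The digits are representatives of least absolute value of the residue
  classes, and a product of blocks can be decoded because its lamp at \<open>0\<close> shows the first digit: the remaining
  blocks only change lamps at positive positions.\<close>

theorem growth_rate_lamplighter_digits:
  fixes D :: "int set" and r :: real
  assumes "n \<ge> 2" "finite D" "0 \<in> D"
    and digit: "\<And>c. \<exists>d\<in>D. d mod int n = c mod int n \<and> \<bar>d\<bar> \<le> \<bar>c\<bar>"
    and inj: "inj_on (\<lambda>d. d mod int n) D"
    and r: "r > 0" "(\<Sum>d\<in>D. (1 / r) ^ (nat \<bar>d\<bar> + 1)) = 1"
  shows "growth_rate (lamplighter n) {lamp_a, lamp_t} = r"
proof -
  interpret shift_group "lamplighter n" lamp_a lamp_t
    by (rule shift_group_lamplighter) fact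
  let ?B = "(\<lambda>d. (d, 1::nat)) ` D"
  have t1: "lamp_t [^]\<^bsub>lamplighter n\<^esub> (1::nat) = (\<lambda>i. 0, 1)"
    using lamp_t_nat_pow[of n 1] by (simp only: of_nat_1)
  have step: "block_prod ((d, 1) # bs)
      = ((\<lambda>i. ((if i = 0 then d else 0) + fst (block_prod bs) (i - 1)) mod int n),
         1 + snd (block_prod bs))" for d bs
    unfolding block_prod.simps fst_conv snd_conv t1 lamp_a_int_pow[OF \<open>n \<ge> 2\<close>]
    by (cases "block_prod bs") (auto simp: mult_lamplighter mod_simps fun_eq_iff)
  have negative: "fst (block_prod bs) i = 0" if "set bs \<subseteq> ?B" "i < 0" for bs and i :: int
    using that
  proof (induction bs arbitrary: i)
    case Nil
    then show ?case by (simp add: one_lamplighter)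
  next
    case (Cons b bs)
    then obtain d where b: "b = (d, 1)" by auto
    show ?case using Cons unfolding b step by simp
  qed
  interpret block_system "lamplighter n" lamp_a lamp_t ?B 1 r
  proof unfold_locales
    show "finite ?B" "(0, 1) \<in> ?B" "r > 0" using assms by auto
    show "m > 0" if "(d, m) \<in> ?B" for d m using that by auto
    show "(\<Sum>b\<in>?B. (1 / r) ^ block_weight b) = 1"
      using r(2) by (subst sum.reindex) (auto simp: inj_on_def block_weight_def)
    show "\<exists>d m cs'. (d, m) \<in> ?B \<and> length cs = m + length cs' \<and>
        nat \<bar>d\<bar> + cost cs' \<le> cost cs \<and> shift_prod cs = shift_prod (d # replicate (m - 1) 0 @ cs')"
      if cs: "length cs > 1" for cs
    proof -
      obtain c cs' where 1: "cs = c # cs'" using cs by (cases cs) auto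
      obtain d where d: "d \<in> D" "d mod int n = c mod int n" "\<bar>d\<bar> \<le> \<bar>c\<bar>"
        using digit by blast
      have "lamp_a [^]\<^bsub>lamplighter n\<^esub> c = lamp_a [^]\<^bsub>lamplighter n\<^esub> d"
        using d(2) by (simp add: lamp_a_int_pow[OF \<open>n \<ge> 2\<close>] cong: if_cong)
      with 1 d show ?thesis
        by (intro exI[of _ d] exI[of _ "1::nat"] exI[of _ cs']) auto
    qed
    show "b = b'" if b: "b \<in> ?B" "b' \<in> ?B" "set bs \<subseteq> ?B" "set bs' \<subseteq> ?B"
      "block_prod (b # bs) = block_prod (b' # bs')" for b b' bs bs'
    proof -
      obtain d d' where d: "d \<in> D" "d' \<in> D" "b = (d, 1)" "b' = (d', 1)"
        using b by auto
      have "fst (block_prod (b # bs)) 0 = d mod int n" "fst (block_prod (b' # bs')) 0 = d' mod int n"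
        using negative[OF b(3), of "-1"] negative[OF b(4), of "-1"] unfolding d step by simp_all
      then show ?thesis using b(5) d inj by (auto dest: inj_onD)
    qed
  qed
  show ?thesis by (rule growth_rate_eq)
qed

section \<open>Baumslag-Solitar groups\<close>

text \<open>A group generated by \<open>a\<close> and \<open>t\<close> that satisfies the relation of \<open>BS(1, n)\<close>.\<close>

locale bs_group = group G for G (structure) +
  fixes a t :: 'a and n :: nat
  assumes a_closed: "a \<in> carrier G" and t_closed: "t \<in> carrier G"
    and generate_at: "generate G {a, t} = carrier G"
    and relation: "t \<otimes> a \<otimes> inv t = a [^] n"
begin

lemma conj_int_pow: "t \<otimes> a [^] i \<otimes> inv t = a [^] (int n * i)" for i :: int
proof -
  note [simp] = a_closed t_closed
  interpret conj: group_hom G G "\<lambda>x. t \<otimes> x \<otimes> inv t"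
  proof (unfold_locales, rule homI)
    fix x y assume xy: "x \<in> carrier G" "y \<in> carrier G"
    then have "inv t \<otimes> (t \<otimes> (y \<otimes> inv t)) = y \<otimes> inv t"
      by (simp flip: m_assoc)
    with xy show "t \<otimes> (x \<otimes> y) \<otimes> inv t = t \<otimes> x \<otimes> inv t \<otimes> (t \<otimes> y \<otimes> inv t)"
      by (simp add: m_assoc)
  qed simp
  have "t \<otimes> a [^] i \<otimes> inv t = (t \<otimes> a \<otimes> inv t) [^] i"
    by (rule conj.hom_int_pow) simp
  also have "\<dots> = a [^] (int n * i)"
    using int_pow_pow[of a "int n" i] by (simp add: relation int_pow_int mult.commute)
  finally show ?thesis .
qed

lemma conj_pow_int_pow: "t [^] p \<otimes> a [^] i \<otimes> inv (t [^] p) = a [^] (int n ^ p * i)" for p :: nat and i :: int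
proof (induction p arbitrary: i)
  case 0
  then show ?case using a_closed by simp
next
  case (Suc p)
  have "t [^] Suc p \<otimes> a [^] i \<otimes> inv (t [^] Suc p)
      = t [^] p \<otimes> (t \<otimes> a [^] i \<otimes> inv t) \<otimes> inv (t [^] p)"
    using a_closed t_closed by (simp add: m_assoc inv_mult_group)
  then show ?case
    by (simp add: conj_int_pow Suc mult.assoc mult.left_commute)
qed

sublocale shift_group G a t
proof unfold_locales
  show "(t [^] p \<otimes> a [^] i \<otimes> inv (t [^] p)) \<otimes> a [^] j = a [^] j \<otimes> (t [^] p \<otimes> a [^] i \<otimes> inv (t [^] p))"
    for p :: nat and i j :: int
    unfolding conj_pow_int_pow using a_closed by (simp add: add.commute flip: int_pow_mult)
qed (rule a_closed t_closed generate_at)+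

text \<open>Carrying \<open>e\<close> from one coefficient to the next.\<close>

lemma shift_prod_carry: "shift_prod ((d + int n * e) # c # cs) = shift_prod (d # (c + e) # cs)"
proof -
  let ?v = "t \<otimes> shift_prod cs \<otimes> inv t"
  have v: "?v \<in> carrier G" by simp
  have "shift_prod (d # (c + e) # cs) = a [^] d \<otimes> ((t \<otimes> a [^] e \<otimes> inv t) \<otimes> (t \<otimes> (a [^] c \<otimes> ?v) \<otimes> inv t))"
    using v by (simp add: m_assoc add.commute[of c] int_pow_mult)
  also have "\<dots> = shift_prod ((d + int n * e) # c # cs)"
    using v unfolding conj_int_pow by (simp add: m_assoc int_pow_mult)
  finally show ?thesis by simp
qed

end

lemma cost_add_le: "cost ((c + e) # cs) \<le> nat \<bar>e\<bar> + cost (c # cs)"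
proof -
  have "nat \<bar>c + e\<bar> \<le> nat \<bar>e\<bar> + nat \<bar>c\<bar>" by linarith
  then show ?thesis unfolding cost_simps by linarith
qed

text \<open>The choice between the digits \<open>1\<close> and \<open>-1\<close> for an odd coefficient \<open>c\<close> is made such that the next coefficient
  \<open>c'\<close> becomes even after the carry \<open>u\<close>, so that its digit is \<open>0\<close>; the carry \<open>v\<close> is then passed on.\<close>

lemma nonadjacent_digit:
  fixes c c' :: int
  assumes "odd c"
  obtains d u v where "d = 1 \<or> d = - 1" "c = d + 2 * u" "c' + u = 2 * v"
    "1 + \<bar>v\<bar> \<le> \<bar>c\<bar> + \<bar>c'\<bar>"
proof -
  obtain w where w: "c = 2 * w + 1" using assms by (rule oddE)
  show ?thesis
  proof (cases "even (c' + w)")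
    case True
    then obtain v where v: "c' + w = 2 * v" by (rule evenE)
    have "1 + \<bar>v\<bar> \<le> \<bar>c\<bar> + \<bar>c'\<bar>" using v w by linarith
    with v w show ?thesis by (intro that[of 1 w v]) simp_all
  next
    case False
    then obtain v where v: "c' + w = 2 * v + 1" by (rule oddE)
    have "1 + \<bar>v + 1\<bar> \<le> \<bar>c\<bar> + \<bar>c'\<bar>"
      using v w by (cases "w = 0 \<or> w = - 1"; cases "v \<ge> 0") (auto simp: abs_if)
    with v w show ?thesis by (intro that[of "- 1" "w + 1" "v + 1"]) simp_all
  qed
qed

lemma binary_block_unique:
  fixes b b' :: "int \<times> nat" and z z' :: int
  assumes "b \<in> {(0, 1), (1, 2), (- 1, 2)}" "b' \<in> {(0, 1), (1, 2), (- 1, 2)}"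
    and "fst b + 2 ^ snd b * z = fst b' + 2 ^ snd b' * z'"
  shows "b = b'"
proof -
  have "(2 * z \<noteq> 1 + 4 * z')" "(2 * z \<noteq> - 1 + 4 * z')" "(1 + 4 * z \<noteq> 2 * z')"
    "(- 1 + 4 * z \<noteq> 2 * z')" "(1 + 4 * z \<noteq> - 1 + 4 * z')" "(- 1 + 4 * z \<noteq> 1 + 4 * z')"
    by presburger+
  with assms show ?thesis by auto
qed

text \<open>The function \<open>val\<close> plays the role of the value at \<open>0\<close> of the affine map that represents an element, where
  \<open>a\<close> acts by \<open>x \<mapsto> x + 1\<close> and \<open>t\<close> by \<open>x \<mapsto> n x\<close>. On a product of blocks it is an
  integer, whose residue determines the first digit.\<close>

locale bs_group_value = bs_group +
  fixes val :: "'a \<Rightarrow> real"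
  assumes value_one: "val \<one> = 0"
    and value_a: "x \<in> carrier G \<Longrightarrow> val (a \<otimes> x) = 1 + val x"
    and value_t: "x \<in> carrier G \<Longrightarrow> val (t \<otimes> x) = real n * val x"
begin

lemma value_a_int_pow:
  fixes d :: int
  assumes x: "x \<in> carrier G"
  shows "val (a [^] d \<otimes> x) = of_int d + val x"
proof -
  have nat: "val (a [^] k \<otimes> x) = real k + val x" if "x \<in> carrier G" for k :: nat and x
    using that
  proof (induction k arbitrary: x)
    case (Suc k)
    then have "val (a [^] k \<otimes> (a \<otimes> x)) = real k + val (a \<otimes> x)" by (intro Suc.IH) simp
    with Suc.prems show ?case by (simp add: m_assoc value_a)
  qed simp
  show ?thesis
  proof (cases "d < 0")
    case True
    then have d: "a [^] d = inv (a [^] nat (- d))" by (simp only: int_pow_def2 if_True)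
    have "a [^] nat (- d) \<otimes> (a [^] d \<otimes> x) = x"
      unfolding d using x by (intro cancel_left) simp_all
    then have "val x = real (nat (- d)) + val (a [^] d \<otimes> x)"
      using nat[of "a [^] d \<otimes> x" "nat (- d)"] x by (metis a_closed int_pow_closed m_closed)
    with True show ?thesis by simp
  next
    case False
    then have "a [^] d = a [^] nat d" by (simp only: int_pow_def2 if_False)
    with nat[OF x, of "nat d"] have "val (a [^] d \<otimes> x) = real (nat d) + val x" by simp
    with False show ?thesis by simp
  qed
qed

lemma value_t_pow: "x \<in> carrier G \<Longrightarrow> val (t [^] m \<otimes> x) = real n ^ m * val x" for m :: nat
  by (induction m arbitrary: x) (simp_all add: m_assoc value_t)

lemma value_block_prod_Cons:
  "val (block_prod (b # bs)) = of_int (fst b) + real n ^ snd b * val (block_prod bs)"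
  by (simp add: m_assoc value_a_int_pow value_t_pow)

lemma value_block_prod_int: "\<exists>z::int. val (block_prod bs) = of_int z"
proof (induction bs)
  case Nil
  show ?case by (rule exI[of _ 0]) (simp add: value_one)
next
  case (Cons b bs)
  then obtain z :: int where "val (block_prod bs) = of_int z" by blast
  then have "val (block_prod (b # bs)) = of_int (fst b + int n ^ snd b * z)"
    by (simp only: value_block_prod_Cons) simp
  then show ?case by blast
qed

lemma block_prod_eq_imp:
  assumes "block_prod ((d, m) # bs) = block_prod ((d', m') # bs')"
  obtains z z' where "d + int n ^ m * z = d' + int n ^ m' * z'"
proof -
  obtain z z' :: int where z: "val (block_prod bs) = of_int z" "val (block_prod bs') = of_int z'"
    using value_block_prod_int by metis
  have "(of_int (d + int n ^ m * z) :: real) = of_int (d' + int n ^ m' * z')"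
    using value_block_prod_Cons[of "(d, m)" bs] value_block_prod_Cons[of "(d', m')" bs'] assms z by simp
  then show ?thesis using that by (simp only: of_int_eq_iff)
qed

text \<open>An even coefficient leaves the block \<open>(0, 1)\<close>, an odd one the block \<open>(1, 2)\<close> or \<open>(-1, 2)\<close>.\<close>

lemma reduce_2:
  assumes n: "n = 2" and cs: "length cs > 2"
  shows "\<exists>d m cs'. (d, m) \<in> {(0, 1), (1, 2), (- 1, 2)} \<and> length cs = m + length cs' \<and>
    nat \<bar>d\<bar> + cost cs' \<le> cost cs \<and> shift_prod cs = shift_prod (d # replicate (m - 1) 0 @ cs')"
    (is "\<exists>d m cs'. ?P d m cs'")
proof -
  obtain c cs\<^sub>1 where 1: "cs = c # cs\<^sub>1" using cs by (cases cs) simp_all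
  obtain c' cs\<^sub>2 where 2: "cs\<^sub>1 = c' # cs\<^sub>2" using cs 1 by (cases cs\<^sub>1) simp_all
  obtain c'' cs' where 3: "cs\<^sub>2 = c'' # cs'" using cs 1 2 by (cases cs\<^sub>2) simp_all
  show ?thesis
  proof (cases "even c")
    case True
    then obtain e where c: "c = 2 * e" by (rule evenE)
    have "shift_prod ((0 + int n * e) # c' # cs\<^sub>2) = shift_prod (0 # (c' + e) # cs\<^sub>2)"
      by (rule shift_prod_carry)
    moreover have "cost ((c' + e) # cs\<^sub>2) \<le> cost (c # c' # cs\<^sub>2)"
      using cost_add_le[of c' e cs\<^sub>2] c by (simp add: abs_mult nat_mult_distrib)
    ultimately have "?P 0 1 ((c' + e) # cs\<^sub>2)"
      using 1 2 c n by simp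
    then show ?thesis by blast
  next
    case False
    obtain d u v where d: "d = 1 \<or> d = - 1" and c: "c = d + 2 * u" and c': "c' + u = 2 * v"
      and le: "1 + \<bar>v\<bar> \<le> \<bar>c\<bar> + \<bar>c'\<bar>"
      using False by (rule nonadjacent_digit)
    have "shift_prod ((d + int n * u) # c' # cs\<^sub>2) = shift_prod (d # (c' + u) # cs\<^sub>2)"
      by (rule shift_prod_carry)
    moreover have "shift_prod ((0 + int n * v) # c'' # cs') = shift_prod (0 # (c'' + v) # cs')"
      by (rule shift_prod_carry)
    ultimately have sp: "shift_prod cs = shift_prod (d # 0 # (c'' + v) # cs')"
      using c c' n 1 2 3 by simp
    moreover have "nat \<bar>d\<bar> + cost ((c'' + v) # cs') \<le> cost cs"
    proof -
      have "1 + nat \<bar>v\<bar> \<le> nat \<bar>c\<bar> + nat \<bar>c'\<bar>" using le by linarith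
      moreover have "nat \<bar>d\<bar> = 1" using d by auto
      ultimately show ?thesis using cost_add_le[of c'' v cs'] unfolding 1 2 3 cost_simps(2) by linarith
    qed
    moreover have "shift_prod cs = shift_prod (d # replicate (2 - 1) 0 @ (c'' + v) # cs')"
      unfolding sp by simp
    moreover have "(d, 2) \<in> {(0, 1), (1, 2), (- 1, 2)}" using d by auto
    moreover have "length cs = 2 + length ((c'' + v) # cs')" using 1 2 3 by simp
    ultimately have "?P d 2 ((c'' + v) # cs')" by blast
    then show ?thesis by blast
  qed
qed

theorem growth_rate_2:
  fixes r :: real
  assumes n: "n = 2" and r: "r > 0" "1 / r + 2 * (1 / r) ^ 3 = 1"
  shows "growth_rate G {a, t} = r"
proof -
  let ?B = "{(0, 1), (1, 2), (- 1, 2)} :: (int \<times> nat) set"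
  have kraft: "(\<Sum>b\<in>?B. (1 / r) ^ block_weight b) = 1"
  proof -
    have "block_weight (0, 1) = 1" "block_weight (1, 2) = 3" "block_weight (- 1, 2) = 3"
      by (simp_all add: block_weight_def)
    then have "(\<Sum>b\<in>?B. (1 / r) ^ block_weight b) = 1 / r + ((1 / r) ^ 3 + (1 / r) ^ 3)" by simp
    with r(2) show ?thesis by linarith
  qed
  interpret block_system G a t ?B 2 r
  proof unfold_locales
    show "\<exists>d m cs'. (d, m) \<in> ?B \<and> length cs = m + length cs' \<and>
        nat \<bar>d\<bar> + cost cs' \<le> cost cs \<and> shift_prod cs = shift_prod (d # replicate (m - 1) 0 @ cs')"
      if "length cs > 2" for cs
      using n that by (rule reduce_2)
    show "b = b'" if b: "b \<in> ?B" "b' \<in> ?B"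
      "block_prod (b # bs) = block_prod (b' # bs')" for b b' bs bs'
    proof -
      obtain z z' where "fst b + int n ^ snd b * z = fst b' + int n ^ snd b' * z'"
        using block_prod_eq_imp[of "fst b" "snd b" bs "fst b'" "snd b'" bs'] b(3)
        unfolding prod.collapse by blast
      then show ?thesis
        unfolding n of_nat_numeral by (rule binary_block_unique[OF b(1,2)])
    qed
    show "m > 0" if "(d, m) \<in> ?B" for d m using that by auto
    show "(\<Sum>b\<in>?B. (1 / r) ^ block_weight b) = 1" by (rule kraft)
  qed (simp_all add: r(1))
  show ?thesis by (rule growth_rate_eq)
qed

end

text \<open>Replacing a coefficient by a balanced digit and a carry is free: each unit of carry removes \<open>2k + 1\<close> from
  the coefficient, and pays for the digit.\<close>

lemma balanced_digit:
  fixes c :: int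
  assumes "k \<ge> 1"
  obtains d e where "d \<in> {- int k..int k}" "c = d + int (2 * k + 1) * e" "\<bar>d\<bar> + \<bar>e\<bar> \<le> \<bar>c\<bar>"
proof -
  define n where "n = 2 * int k + 1"
  define d e where "d = (c + int k) mod n - int k" and "e = (c + int k) div n"
  have n: "n > 0" "int (2 * k + 1) = n" by (simp_all add: n_def)
  have c: "c = d + n * e"
    unfolding d_def e_def using mult_div_mod_eq[of n "c + int k"] by linarith
  have d: "d \<in> {- int k..int k}"
    using pos_mod_bound[OF n(1), of "c + int k"] pos_mod_sign[OF n(1), of "c + int k"]
    unfolding d_def n_def atLeastAtMost_iff by linarith
  have "\<bar>d\<bar> + \<bar>e\<bar> \<le> \<bar>c\<bar>"
  proof (cases "e = 0")
    case True
    with c show ?thesis by simp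
  next
    case False
    then have "int k * 1 \<le> int k * \<bar>e\<bar>" by (intro mult_left_mono) linarith+
    moreover have "\<bar>n * e\<bar> = 2 * (int k * \<bar>e\<bar>) + \<bar>e\<bar>"
      unfolding abs_mult using n(1) by (simp add: n_def distrib_right)
    moreover have "\<bar>d\<bar> \<le> int k" using d by (simp add: abs_le_iff)
    moreover have "\<bar>n * e\<bar> \<le> \<bar>c\<bar> + \<bar>d\<bar>" unfolding c by linarith
    ultimately show ?thesis by linarith
  qed
  with d c n(2) that show ?thesis by blast
qed

lemma balanced_digit_unique:
  assumes "d \<in> {- int k..int k}" "d' \<in> {- int k..int k}" "int (2 * k + 1) dvd d - d'"
  shows "d = d'"
proof (rule ccontr)
  assume "d \<noteq> d'"
  then have "\<bar>int (2 * k + 1)\<bar> \<le> \<bar>d - d'\<bar>" using assms(3) by (intro dvd_imp_le_int) auto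
  then show False using assms(1,2) unfolding atLeastAtMost_iff by linarith
qed

theorem (in bs_group_value) growth_rate_odd:
  fixes r :: real
  assumes n: "n = 2 * k + 1" "k \<ge> 1"
    and r: "r > 0" "(\<Sum>d\<in>{- int k..int k}. (1 / r) ^ (nat \<bar>d\<bar> + 1)) = 1"
  shows "growth_rate G {a, t} = r"
proof -
  let ?B = "(\<lambda>d. (d, 1::nat)) ` {- int k..int k}"
  interpret block_system G a t ?B 1 r
  proof unfold_locales
    show "finite ?B" "(0, 1) \<in> ?B" "r > 0" using r by auto
    show "m > 0" if "(d, m) \<in> ?B" for d m using that by auto
    show "(\<Sum>b\<in>?B. (1 / r) ^ block_weight b) = 1"
      using r(2) by (subst sum.reindex) (auto simp: inj_on_def block_weight_def)
    show "\<exists>d m cs'. (d, m) \<in> ?B \<and> length cs = m + length cs' \<and>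
        nat \<bar>d\<bar> + cost cs' \<le> cost cs \<and> shift_prod cs = shift_prod (d # replicate (m - 1) 0 @ cs')"
      if cs: "length cs > 1" for cs
    proof -
      obtain c cs\<^sub>1 where 1: "cs = c # cs\<^sub>1" using cs by (cases cs) simp_all
      obtain c' cs' where 2: "cs\<^sub>1 = c' # cs'" using cs 1 by (cases cs\<^sub>1) simp_all
      obtain d e where d: "d \<in> {- int k..int k}" "c = d + int n * e" "\<bar>d\<bar> + \<bar>e\<bar> \<le> \<bar>c\<bar>"
        using balanced_digit[OF n(2), of c] n(1) by blast
      have "shift_prod cs = shift_prod (d # (c' + e) # cs')"
        unfolding 1 2 d(2) by (rule shift_prod_carry)
      then have "shift_prod cs = shift_prod (d # replicate (1 - 1) 0 @ (c' + e) # cs')" by simp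
      moreover have "nat \<bar>d\<bar> + cost ((c' + e) # cs') \<le> cost cs"
      proof -
        have "nat \<bar>d\<bar> + nat \<bar>e\<bar> \<le> nat \<bar>c\<bar>" using d(3) by linarith
        then show ?thesis using cost_add_le[of c' e cs'] unfolding 1 2 cost_simps(2) by linarith
      qed
      moreover have "(d, 1) \<in> ?B" using d(1) by blast
      moreover have "length cs = 1 + length ((c' + e) # cs')" using 1 2 by simp
      ultimately show ?thesis by blast
    qed
    show "b = b'" if b: "b \<in> ?B" "b' \<in> ?B"
      "block_prod (b # bs) = block_prod (b' # bs')" for b b' bs bs'
    proof -
      obtain z z' where "fst b + int n ^ snd b * z = fst b' + int n ^ snd b' * z'"
        using block_prod_eq_imp[of "fst b" "snd b" bs "fst b'" "snd b'" bs'] b(3)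
        unfolding prod.collapse by blast
      moreover have "snd b = 1" "snd b' = 1" using b(1,2) by auto
      ultimately have "fst b + int n * z = fst b' + int n * z'" by simp
      then have "fst b - fst b' = int n * (z' - z)" unfolding right_diff_distrib by linarith
      then have "int (2 * k + 1) dvd fst b - fst b'" using n(1) by (metis dvd_triv_left)
      then have "fst b = fst b'"
        using b(1,2) by (intro balanced_digit_unique) auto
      then show ?thesis using b(1,2) by auto
    qed
  qed
  show ?thesis by (rule growth_rate_eq)
qed

text \<open>The action of \<open>BS(1, n)\<close> on the real line by affine maps, on letters and on words.\<close>

primrec letter_map :: "nat \<Rightarrow> bs_gen \<Rightarrow> bool \<Rightarrow> real \<Rightarrow> real" where
  "letter_map n Gen_a = (\<lambda>b x. if b then x + 1 else x - 1)"
| "letter_map n Gen_t = (\<lambda>b x. if b then real n * x else x / real n)"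

definition word_map :: "nat \<Rightarrow> bs_gen word \<Rightarrow> real \<Rightarrow> real" where
  "word_map n w = foldr (\<lambda>(g, b). letter_map n g b) w"

lemma word_map_respects:
  assumes "n > 0" "pres_eq (BS1_relations n) u v"
  shows "word_map n u = word_map n v"
  using assms(2)
proof induction
  case (pres_append u u' v v')
  then show ?case by (simp add: word_map_def)
next
  case (pres_cancel g b)
  show ?case using assms(1) by (cases g; cases b) (auto simp: word_map_def fun_eq_iff)
next
  case (pres_rel u v)
  have "foldr (\<lambda>(g, b). letter_map n g b) (replicate m (Gen_a, True)) x = x + real m" for m x
    by (induction m) auto
  with pres_rel assms(1) show ?case
    by (auto simp: word_map_def BS1_relations_def fun_eq_iff field_simps)
qed auto

text \<open>The image of \<open>0\<close> under a group element. For \<open>n > 0\<close>, by \<open>word_map_respects\<close>, it can be computed from any word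
  in the class.\<close>

definition BS1_value :: "nat \<Rightarrow> bs_gen word set \<Rightarrow> real" where
  "BS1_value n X = word_map n (SOME w. w \<in> X) 0"

lemma BS1_value_class:
  assumes "n > 0"
  shows "BS1_value n (pres_class (BS1_relations n) w) = word_map n w 0"
proof -
  have "w \<in> pres_class (BS1_relations n) w" by (simp add: pres_class_def pres_refl)
  then have "(SOME v. v \<in> pres_class (BS1_relations n) w) \<in> pres_class (BS1_relations n) w"
    by (rule someI)
  then show ?thesis
    using word_map_respects[OF assms] unfolding BS1_value_def pres_class_def by (metis mem_Collect_eq)
qed

lemma bs_group_value_BS1:
  assumes "n > 0"
  shows "bs_group_value (BS1 n) (BS1_a n) (BS1_t n) n (BS1_value n)"
proof -
  interpret G: group "BS1 n" by (rule group_BS1)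
  let ?R = "BS1_relations n"
  have car: "carrier (BS1 n) = range (pres_class ?R)"
    by (simp add: BS1_def carrier_presented_group)
  have mult: "pres_class ?R u \<otimes>\<^bsub>BS1 n\<^esub> pres_class ?R v = pres_class ?R (u @ v)" for u v
    by (simp add: BS1_def)
  have one: "\<one>\<^bsub>BS1 n\<^esub> = pres_class ?R []"
    by (simp add: BS1_def one_presented_group)
  have inv_t: "inv\<^bsub>BS1 n\<^esub> (BS1_t n) = pres_class ?R [(Gen_t, False)]"
    by (simp add: BS1_def BS1_t_def inv_pres_class)
  have pow: "BS1_a n [^]\<^bsub>BS1 n\<^esub> m = pres_class ?R (replicate m (Gen_a, True))" for m :: nat
    by (induction m) (simp_all add: one BS1_a_def mult replicate_append_same)
  have rel: "pres_class ?R [(Gen_t, True), (Gen_a, True), (Gen_t, False)] = pres_class ?R (replicate n (Gen_a, True))"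
    unfolding pres_class_eq_iff by (rule pres_rel) (simp add: BS1_relations_def)
  show ?thesis
  proof unfold_locales
    show "BS1_a n \<in> carrier (BS1 n)" "BS1_t n \<in> carrier (BS1 n)"
      by (auto simp: car BS1_a_def BS1_t_def)
    show "generate (BS1 n) {BS1_a n, BS1_t n} = carrier (BS1 n)" by (rule generate_BS1)
    show "BS1_t n \<otimes>\<^bsub>BS1 n\<^esub> BS1_a n \<otimes>\<^bsub>BS1 n\<^esub> inv\<^bsub>BS1 n\<^esub> BS1_t n = BS1_a n [^]\<^bsub>BS1 n\<^esub> n"
      unfolding inv_t pow by (simp add: BS1_a_def BS1_t_def mult rel)
    show "BS1_value n \<one>\<^bsub>BS1 n\<^esub> = 0"
      by (simp add: one BS1_value_class assms word_map_def)
    show "BS1_value n (BS1_a n \<otimes>\<^bsub>BS1 n\<^esub> x) = 1 + BS1_value n x"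
      "BS1_value n (BS1_t n \<otimes>\<^bsub>BS1 n\<^esub> x) = real n * BS1_value n x" if "x \<in> carrier (BS1 n)" for x
      using that by (auto simp: car BS1_a_def BS1_t_def mult BS1_value_class assms word_map_def)
  qed
qed

section \<open>The characteristic equations\<close>

lemma T_poly_eq_0_iff:
  fixes x :: real
  assumes "x > 0"
  shows "T_poly k x = 0 \<longleftrightarrow> (\<Sum>d\<in>{- int k..int k}. (1 / x) ^ (nat \<bar>d\<bar> + 1)) = 1"
proof -
  let ?f = "\<lambda>d::int. (1 / x) ^ (nat \<bar>d\<bar> + 1)"
  have "x ^ (k + 1) * sum ?f {- int k..int k} = x ^ k + 2 * (\<Sum>j<k. x ^ j)"
  proof (induction k)
    case 0
    then show ?case using assms by simp
  next
    case (Suc k)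
    have "{- int (Suc k)..int (Suc k)} = insert (- int (Suc k)) (insert (int (Suc k)) {- int k..int k})"
      by auto
    then have "sum ?f {- int (Suc k)..int (Suc k)} = 2 * (1 / x) ^ (k + 2) + sum ?f {- int k..int k}"
      by (simp add: nat_add_distrib)
    then have "x ^ (Suc k + 1) * sum ?f {- int (Suc k)..int (Suc k)}
        = 2 * (x ^ (k + 2) * (1 / x) ^ (k + 2)) + x * (x ^ (k + 1) * sum ?f {- int k..int k})"
      by (simp only: distrib_left) (simp add: algebra_simps)
    also have "x ^ (k + 2) * (1 / x) ^ (k + 2) = 1"
      using assms by (simp flip: power_mult_distrib)
    also have "2 * 1 + x * (x ^ (k + 1) * sum ?f {- int k..int k})
        = 2 + x * (x ^ k + 2 * (\<Sum>j<k. x ^ j))" by (simp only: Suc.IH)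
    also have "\<dots> = x ^ Suc k + 2 * (\<Sum>j<Suc k. x ^ j)"
    proof -
      have "(\<Sum>j<Suc k. x ^ j) = 1 + x * (\<Sum>j<k. x ^ j)"
        by (simp add: sum.lessThan_Suc_shift sum_distrib_left del: sum.lessThan_Suc)
      then show ?thesis by (simp add: distrib_left)
    qed
    finally show ?case .
  qed
  then have "T_poly k x = x ^ (k + 1) * (1 - sum ?f {- int k..int k})"
    by (simp add: T_poly_def right_diff_distrib)
  then show ?thesis using assms by simp
qed

lemma omega_root: "omega k > 0" "(\<Sum>d\<in>{- int k..int k}. (1 / omega k) ^ (nat \<bar>d\<bar> + 1)) = 1"
proof -
  have "\<exists>!x. x > 0 \<and> T_poly k x = 0"
    using ex1_kraft_root[of "{- int k..int k}" "\<lambda>d. nat \<bar>d\<bar> + 1"] by (auto simp: T_poly_eq_0_iff cong: conj_cong)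
  from theI'[OF this] show "omega k > 0" "(\<Sum>d\<in>{- int k..int k}. (1 / omega k) ^ (nat \<bar>d\<bar> + 1)) = 1"
    unfolding omega_def[symmetric] using T_poly_eq_0_iff by blast+
qed

lemma cubic_root:
  defines "x \<equiv> THE x::real. x > 0 \<and> x ^ 3 - x ^ 2 - 2 = 0"
  shows "x > 0" "1 / x + 2 * (1 / x) ^ 3 = 1"
proof -
  have eq: "x ^ 3 - x ^ 2 - 2 = 0 \<longleftrightarrow> 1 / x + 2 * (1 / x) ^ 3 = 1" if "x > 0" for x :: real
    using that by (simp add: field_simps power2_eq_square power3_eq_cube)
  \<comment> \<open>The three indices stand for the blocks of weights \<open>1\<close>, \<open>3\<close> and \<open>3\<close>.\<close>
  have "\<exists>!x::real. x > 0 \<and> (\<Sum>i\<in>{0, 1, 2::nat}. (1 / x) ^ (if i = 0 then 1 else 3)) = 1"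
    by (rule ex1_kraft_root) auto
  then have "\<exists>!x::real. x > 0 \<and> 1 / x + 2 * (1 / x) ^ 3 = 1" by simp
  then have ex1: "\<exists>!x::real. x > 0 \<and> x ^ 3 - x ^ 2 - 2 = 0"
    by (simp only: eq cong: conj_cong)
  have "x > 0 \<and> x ^ 3 - x ^ 2 - 2 = 0" unfolding x_def by (rule theI'[OF ex1])
  then show "x > 0" "1 / x + 2 * (1 / x) ^ 3 = 1" using eq by blast+
qed

lemma golden_ratio_kraft:
  defines "\<phi> \<equiv> (1 + sqrt 5) / 2"
  shows "\<phi> > 0" "(\<Sum>d\<in>{0, 1::int}. (1 / \<phi>) ^ (nat \<bar>d\<bar> + 1)) = 1"
proof -
  show pos: "\<phi> > 0" by (simp add: \<phi>_def add_pos_nonneg)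
  have "\<phi> ^ 2 = \<phi> + 1" by (simp add: \<phi>_def power2_eq_square field_simps)
  then show "(\<Sum>d\<in>{0, 1::int}. (1 / \<phi>) ^ (nat \<bar>d\<bar> + 1)) = 1"
    using pos by (simp add: field_simps power2_eq_square)
qed

theorem lemma11:
  shows "growth_rate (lamplighter 2) {lamp_a, lamp_t} = (1 + sqrt 5) / 2 \<and>
    (\<forall>k::nat. k \<ge> 1 \<longrightarrow>
       growth_rate (BS1 (2 * k + 1)) {BS1_a (2 * k + 1), BS1_t (2 * k + 1)}
         = growth_rate (lamplighter (2 * k + 1)) {lamp_a, lamp_t} \<and>
       growth_rate (lamplighter (2 * k + 1)) {lamp_a, lamp_t} = omega k) \<and>
    growth_rate (BS1 2) {BS1_a 2, BS1_t 2}
      = (THE x::real. x > 0 \<and> x ^ 3 - x ^ 2 - 2 = 0)"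
proof (intro conjI allI impI)
  show "growth_rate (lamplighter 2) {lamp_a, lamp_t} = (1 + sqrt 5) / 2"
  proof (rule growth_rate_lamplighter_digits[OF _ _ _ _ _ golden_ratio_kraft])
    show "\<exists>d\<in>{0, 1}. d mod int 2 = c mod int 2 \<and> \<bar>d\<bar> \<le> \<bar>c\<bar>" for c :: int
      by (intro bexI[of _ "c mod 2"]) (auto, presburger+)
  qed auto
next
  fix k :: nat assume k: "k \<ge> 1"
  interpret bs_group_value "BS1 (2 * k + 1)" "BS1_a (2 * k + 1)" "BS1_t (2 * k + 1)" "2 * k + 1"
    "BS1_value (2 * k + 1)"
    by (rule bs_group_value_BS1) simp
  have "growth_rate (BS1 (2 * k + 1)) {BS1_a (2 * k + 1), BS1_t (2 * k + 1)} = omega k"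
    by (rule growth_rate_odd[OF refl k omega_root])
  moreover show "growth_rate (lamplighter (2 * k + 1)) {lamp_a, lamp_t} = omega k"
  proof (rule growth_rate_lamplighter_digits[OF _ _ _ _ _ omega_root])
    show "\<exists>d\<in>{- int k..int k}. d mod int (2 * k + 1) = c mod int (2 * k + 1) \<and> \<bar>d\<bar> \<le> \<bar>c\<bar>" for c
    proof -
      obtain d e where "d \<in> {- int k..int k}" "c = d + int (2 * k + 1) * e" "\<bar>d\<bar> + \<bar>e\<bar> \<le> \<bar>c\<bar>"
        using balanced_digit[OF k, of c] by blast
      then show ?thesis by (intro bexI[of _ d]) auto
    qed
    show "inj_on (\<lambda>d. d mod int (2 * k + 1)) {- int k..int k}"
      by (intro inj_onI balanced_digit_unique) (auto simp: mod_eq_dvd_iff)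
  qed (use k in auto)
  ultimately show "growth_rate (BS1 (2 * k + 1)) {BS1_a (2 * k + 1), BS1_t (2 * k + 1)}
      = growth_rate (lamplighter (2 * k + 1)) {lamp_a, lamp_t}" by simp
next
  interpret bs_group_value "BS1 2" "BS1_a 2" "BS1_t 2" 2 "BS1_value 2"
    by (rule bs_group_value_BS1) simp
  show "growth_rate (BS1 2) {BS1_a 2, BS1_t 2} = (THE x::real. x > 0 \<and> x ^ 3 - x ^ 2 - 2 = 0)"
    by (rule growth_rate_2[OF refl cubic_root])
qed

end
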